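(* Let $n\ge 1$ be an integer and let $A_1,\dots,A_n,B_1,\dots,B_n\in C_p$ for some real $p>0$, such that $\sum_{i,j=1}^n A_i^*B_j=0$. Then, for each choice of the sign $\pm$ (the same sign in all terms of the sum): if $0<p\le 2$, $$\sum_{i,j=1}^n\|A_i\pm B_j\|_p^2\le n^{2/p}\sum_{i=1}^n\left\|\left(|A_i|^2+|B_i|^2\right)^{1/2}\right\|_p^2;$$ and if $2\le p<\infty$, $$n^{2/p}\sum_{i=1}^n\left\|\left(|A_i|^2+|B_i|^2\right)^{1/2}\right\|_p^2\le \sum_{i,j=1}^n\|A_i\pm B_j\|_p^2.$$
   Context: $\mathcal{H}$ is a separable complex Hilbert space and $B(\mathcal{H})$ is the algebra of all bounded linear operators on $\mathcal{H}$. For $A\in B(\mathcal{H})$, $|A|=(A^*A)^{1/2}$. For a compact operator $A\in B(\mathcal{H})$ and $0<p<\infty$, the Schatten $p$-norm (only a quasi-norm when $0<p<1$) is $\|A\|_p=(\operatorname{tr}|A|^p)^{1/p}$, where $\operatorname{tr}$ is the usual trace. The Schatten $p$-class $C_p$ is the set of compact operators $A\in B(\mathcal{H})$ with $\|A\|_p<\infty$; it is a two-sided ideal of $B(\mathcal{H})$. *)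

theory Defs
  imports "HOL-Analysis.Analysis"
begin

text \<open>Complex Hilbert spaces are real Hilbert spaces carrying a compatible complex structure. The
  complex inner product is linear in its first argument; its positive definiteness is inherited
  from the real inner product, which is its real part.\<close>

class chilbert_space = real_inner + banach +
  fixes scaleC :: "complex \<Rightarrow> 'a \<Rightarrow> 'a"
    and cinner :: "'a \<Rightarrow> 'a \<Rightarrow> complex"
  assumes scaleC_add_right: "scaleC c (x + y) = scaleC c x + scaleC c y"
    and scaleC_add_left: "scaleC (c + d) x = scaleC c x + scaleC d x"
    and scaleC_scaleC: "scaleC c (scaleC d x) = scaleC (c * d) x"
    and scaleR_eq_scaleC: "scaleR r x = scaleC (complex_of_real r) x"
    and cinner_commute: "cinner x y = cnj (cinner y x)"
    and cinner_add_left: "cinner (x + y) z = cinner x z + cinner y z"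
    and cinner_scaleC_left: "cinner (scaleC c x) y = c * cinner x y"
    and inner_eq_Re_cinner: "inner x y = Re (cinner x y)"

instantiation complex :: chilbert_space
begin

definition scaleC_complex :: "complex \<Rightarrow> complex \<Rightarrow> complex" where
  "scaleC_complex c x = c * x"

definition cinner_complex :: "complex \<Rightarrow> complex \<Rightarrow> complex" where
  "cinner_complex x y = x * cnj y"

instance
  by standard
    (auto simp: scaleC_complex_def cinner_complex_def algebra_simps scaleR_conv_of_real
      inner_complex_def)

end

definition bounded_clinear :: "('a::chilbert_space \<Rightarrow> 'a) \<Rightarrow> bool" where
  "bounded_clinear T \<longleftrightarrow> bounded_linear T \<and> (\<forall>c x. T (scaleC c x) = scaleC c (T x))"

definition compact_operator :: "('a::chilbert_space \<Rightarrow> 'a) \<Rightarrow> bool" where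
  "compact_operator T \<longleftrightarrow> bounded_clinear T \<and> compact (closure (T ` cball 0 1))"

text \<open>The description determines the Hilbert space adjoint uniquely for every bounded operator.\<close>

definition cadjoint :: "('a::chilbert_space \<Rightarrow> 'a) \<Rightarrow> 'a \<Rightarrow> 'a" where
  "cadjoint T = (THE S. \<forall>x y. cinner (T x) y = cinner x (S y))"

definition positive_operator :: "('a::chilbert_space \<Rightarrow> 'a) \<Rightarrow> bool" where
  "positive_operator T \<longleftrightarrow>
     bounded_clinear T \<and> (\<forall>x. cinner (T x) x \<in> \<real> \<and> 0 \<le> Re (cinner (T x) x))"

text \<open>The positive square root, meaningful for positive \<^term>\<open>T\<close>.\<close>

definition op_sqrt :: "('a::chilbert_space \<Rightarrow> 'a) \<Rightarrow> 'a \<Rightarrow> 'a" where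
  "op_sqrt T = (THE S. positive_operator S \<and> S \<circ> S = T)"

definition op_abs :: "('a::chilbert_space \<Rightarrow> 'a) \<Rightarrow> 'a \<Rightarrow> 'a" where
  "op_abs T = op_sqrt (cadjoint T \<circ> T)"

text \<open>The power \<open>T\<^sup>p\<close> in the sense of functional calculus, for compact positive
  \<^term>\<open>T\<close> and \<open>p > 0\<close>: it acts as the scalar \<open>t\<^sup>p\<close> on the eigenspace of
  \<^term>\<open>T\<close> for \<open>t\<close>. This determines it, since the eigenvectors of a compact positive operator
  span a dense subspace. The kernel is the case \<open>t = 0\<close>, where \<open>0 powr p = 0\<close>.\<close>

definition op_powr :: "('a::chilbert_space \<Rightarrow> 'a) \<Rightarrow> real \<Rightarrow> 'a \<Rightarrow> 'a" where
  "op_powr T p =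
     (THE S. bounded_clinear S \<and> (\<forall>t\<ge>0. \<forall>x. T x = t *\<^sub>R x \<longrightarrow> S x = (t powr p) *\<^sub>R x))"

text \<open>Orthonormal bases in the Hilbert space sense, that is, maximal orthonormal sets.\<close>

definition orthonormal_basis :: "'a::chilbert_space set \<Rightarrow> bool" where
  "orthonormal_basis E \<longleftrightarrow>
     (\<forall>e\<in>E. norm e = 1) \<and> (\<forall>e\<in>E. \<forall>f\<in>E. e \<noteq> f \<longrightarrow> cinner e f = 0) \<and>
     (\<forall>x. (\<forall>e\<in>E. cinner x e = 0) \<longrightarrow> x = 0)"

text \<open>The trace of a positive operator, with values in \<open>[0, \<infinity>]\<close>. It does not depend on the
  orthonormal basis chosen.\<close>

definition pos_trace :: "('a::chilbert_space \<Rightarrow> 'a) \<Rightarrow> ennreal" where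
  "pos_trace T =
     (\<Sum>\<^sub>\<infinity>e\<in>(SOME E. orthonormal_basis E). ennreal (Re (cinner (T e) e)))"

definition schatten_class :: "real \<Rightarrow> ('a::chilbert_space \<Rightarrow> 'a) set" where
  "schatten_class p = {T. compact_operator T \<and> pos_trace (op_powr (op_abs T) p) < \<infinity>}"

text \<open>As \<^const>\<open>enn2real\<close> sends \<open>\<infinity>\<close> to \<open>0\<close>, this is the Schatten norm only on
  \<^term>\<open>schatten_class p\<close>.\<close>

definition schatten_norm :: "real \<Rightarrow> ('a::chilbert_space \<Rightarrow> 'a) \<Rightarrow> real" where
  "schatten_norm p T = enn2real (pos_trace (op_powr (op_abs T) p)) powr (1 / p)"

end

theory Submission
  imports Defs
begin

text \<open>Write \<open>q = p / 2\<close>, \<open>T\<^sub>i = \<bar>A\<^sub>i\<bar>\<^sup>2 + \<bar>B\<^sub>i\<bar>\<^sup>2\<close> and \<open>S\<^sub>i\<^sub>j = \<bar>A\<^sub>i \<plusminus> B\<^sub>j\<bar>\<^sup>2\<close>. The orthogonality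
  hypothesis cancels the cross terms in \<open>\<Sum> S\<^sub>i\<^sub>j = n \<Sum> T\<^sub>i\<close>, and the squared Schatten \<open>p\<close>-norms are
  \<open>q\<close>-(quasi-)norms of these positive operators. For \<open>q \<ge> 1\<close>, the triangle inequality bounds
  \<open>\<parallel>n \<Sum> T\<^sub>i\<parallel>\<^sub>q\<close> by \<open>\<Sum> \<parallel>S\<^sub>i\<^sub>j\<parallel>\<^sub>q\<close>, while the superadditivity of \<open>tr T\<^sup>q\<close> and the power mean
  inequality give \<open>\<parallel>\<Sum> T\<^sub>i\<parallel>\<^sub>q \<ge> n\<^bsup>1/q - 1\<^esup> \<Sum> \<parallel>T\<^sub>i\<parallel>\<^sub>q\<close>. All inequalities are reversed for \<open>q \<le> 1\<close>.
  The trace inequalities are reduced to scalar ones in an eigenbasis of the sum, by Jensen's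
  inequality for the spectral measure of each summand.\<close>

subsection \<open>Complex Hilbert spaces\<close>

text \<open>The two kinds of trace inequality are made scalar in different ways. For the triangle
  inequalities it is enough to look at the diagonal entries of the summands in an eigenbasis of the
  sum: they add up to its eigenvalues, and passing to diagonal entries changes \<open>tr S^q\<close>
  in the useful direction. For super- and subadditivity that direction is the wrong one. There
  \<open>tr S^q\<close> is compared with \<open>tr (S R^(q-1))\<close> for
  \<open>0 \<le> S \<le> R\<close>: this expression is linear in \<open>S\<close>, and over the
  summands \<open>S\<close> of \<open>R\<close> it adds up to exactly \<open>tr R^q\<close>. For
  \<open>q < 1\<close> the power \<open>R^(q-1)\<close> may be unbounded, so it enters only through
  its eigenvalues, in double sums over [0, \<infinity>] that may be rearranged freely. The other
  obstacle is finiteness. A norm whose trace is infinite has the value \<open>0\<close>, so an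
  inequality with such a norm on its larger side could fail. Finiteness passes from the given
  operators to the \<open>T\<close> and to their sum; for \<open>q \<ge> 1\<close> it returns from
  the sum to the \<open>S\<close> by superadditivity.\<close>

lemma cinner_scaleC_right: "cinner x (scaleC c y) = cnj c * cinner (x::'a::chilbert_space) y"
  by (metis cinner_commute cinner_scaleC_left complex_cnj_mult)

lemma cinner_self: "cinner x x = complex_of_real ((norm (x::'a::chilbert_space))\<^sup>2)"
proof -
  have "Im (cinner x x) = 0"
    using cinner_commute[of x x] by (metis Reals_cnj_iff complex_is_Real_iff)
  moreover have "Re (cinner x x) = (norm x)\<^sup>2"
    by (metis inner_eq_Re_cinner power2_norm_eq_inner)
  ultimately show ?thesis
    by (simp add: complex_eq_iff)
qed

lemma norm_scaleC: "norm (scaleC c (x::'a::chilbert_space)) = cmod c * norm x"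
proof -
  have "complex_of_real ((norm (scaleC c x))\<^sup>2) = c * cnj c * cinner x x"
    by (simp only: cinner_self[symmetric] cinner_scaleC_left cinner_scaleC_right mult_ac)
  also have "\<dots> = complex_of_real ((cmod c * norm x)\<^sup>2)"
    by (simp add: complex_norm_square[symmetric] cinner_self power_mult_distrib)
  finally have "(norm (scaleC c x))\<^sup>2 = (cmod c * norm x)\<^sup>2"
    by (simp only: of_real_eq_iff)
  then show ?thesis
    by (simp add: power2_eq_iff_nonneg)
qed

lemma cinner_Cauchy_Schwarz: "cmod (cinner x y) \<le> norm x * norm (y::'a::chilbert_space)"
proof -
  \<comment> \<open>\<open>c\<close> is the phase that rotates \<open>cinner x y\<close> onto the
    nonnegative real axis, where it agrees with a real inner product; if
    \<open>cinner x y = 0\<close>, then \<open>c = 0\<close>.\<close>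
  define c where "c = cnj (sgn (cinner x y))"
  have "c * cinner x y = complex_of_real (cmod (cinner x y))"
    using complex_norm_square[of "cinner x y"]
    by (simp add: c_def sgn_eq divide_simps power2_eq_square mult.commute)
  then have "cmod (cinner x y) = inner (scaleC c x) y"
    by (simp add: inner_eq_Re_cinner cinner_scaleC_left)
  also have "\<dots> \<le> norm (scaleC c x) * norm y"
    by (rule norm_cauchy_schwarz)
  also have "\<dots> \<le> norm x * norm y"
    by (simp add: norm_scaleC c_def norm_sgn mult_right_mono)
  finally show ?thesis .
qed

lemma scaleC_of_real: "scaleC (complex_of_real r) x = r *\<^sub>R x"
  by (simp add: scaleR_eq_scaleC)

lemma bounded_bilinear_cinner: "bounded_bilinear (cinner :: 'a::chilbert_space \<Rightarrow> _)"
proof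
  fix a b c :: 'a and r :: real
  show "cinner (a + b) c = cinner a c + cinner b c"
    by (rule cinner_add_left)
  show "cinner a (b + c) = cinner a b + cinner a c"
    by (metis cinner_add_left cinner_commute complex_cnj_add)
  show "cinner (r *\<^sub>R a) b = r *\<^sub>R cinner a b"
    by (simp add: scaleC_of_real[symmetric, of r a] cinner_scaleC_left scaleR_conv_of_real)
  show "cinner a (r *\<^sub>R b) = r *\<^sub>R cinner a b"
    by (simp add: scaleC_of_real[symmetric, of r b] cinner_scaleC_right scaleR_conv_of_real)
  show "\<exists>K. \<forall>a b::'a. norm (cinner a b) \<le> norm a * norm b * K"
    using cinner_Cauchy_Schwarz by (intro exI[of _ 1]) auto
qed

lemma bounded_bilinear_scaleC: "bounded_bilinear (scaleC :: complex \<Rightarrow> 'a::chilbert_space \<Rightarrow> _)"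
proof
  fix a b :: 'a and c d :: complex and r :: real
  show "scaleC (c + d) a = scaleC c a + scaleC d a"
    by (rule scaleC_add_left)
  show "scaleC c (a + b) = scaleC c a + scaleC c b"
    by (rule scaleC_add_right)
  show "scaleC (r *\<^sub>R c) a = r *\<^sub>R scaleC c a"
    by (simp add: scaleC_of_real[symmetric, where 'a='a] scaleC_scaleC scaleR_conv_of_real)
  show "scaleC c (r *\<^sub>R a) = r *\<^sub>R scaleC c a"
    by (simp add: scaleC_of_real[symmetric] scaleC_scaleC mult.commute)
  show "\<exists>K. \<forall>(c::complex) a::'a. norm (scaleC c a) \<le> norm c * norm a * K"
    by (intro exI[of _ 1]) (auto simp: norm_scaleC)
qed

interpretation cinner: bounded_bilinear "cinner :: 'a::chilbert_space \<Rightarrow> _"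
  by (rule bounded_bilinear_cinner)

interpretation scaleC: bounded_bilinear "scaleC :: complex \<Rightarrow> 'a::chilbert_space \<Rightarrow> _"
  by (rule bounded_bilinear_scaleC)

lemma cinner_eq_0_commute: "cinner x y = 0 \<longleftrightarrow> cinner y (x::'a::chilbert_space) = 0"
  by (metis cinner_commute complex_cnj_zero)

lemma cmod_cinner_commute: "cmod (cinner x y) = cmod (cinner y (x::'a::chilbert_space))"
  by (metis cinner_commute complex_mod_cnj)

lemma cinner_mult_commute: "cinner x y * cinner y x = complex_of_real ((cmod (cinner x (y::'a::chilbert_space)))\<^sup>2)"
  by (metis cinner_commute complex_norm_square)

lemma cinner_eqI:
  assumes "\<And>z. cinner z x = cinner z (y::'a::chilbert_space)"
  shows "x = y"
proof -
  have "cinner (x - y) (x - y) = 0"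
    using assms by (simp add: cinner.diff_right)
  then show ?thesis
    by (simp add: cinner_self)
qed

section \<open>Orthonormal families, Bessel's inequality and Parseval's identity\<close>

definition orthonormal :: "'a::chilbert_space set \<Rightarrow> bool" where
  "orthonormal E \<longleftrightarrow> (\<forall>e\<in>E. norm e = 1) \<and> (\<forall>e\<in>E. \<forall>f\<in>E. e \<noteq> f \<longrightarrow> cinner e f = 0)"

lemma orthonormal_basis_iff:
  "orthonormal_basis E \<longleftrightarrow> orthonormal E \<and> (\<forall>x. (\<forall>e\<in>E. cinner x e = 0) \<longrightarrow> x = 0)"
  by (auto simp: orthonormal_def orthonormal_basis_def)

lemma orthonormal_cinner:
  "orthonormal E \<Longrightarrow> e \<in> E \<Longrightarrow> f \<in> E \<Longrightarrow> cinner e f = (if e = f then 1 else 0)"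
  by (auto simp: orthonormal_def cinner_self)

text \<open>By Pythagoras, the squared distance of two nested partial sums is a difference of
  partial sums of the real series, so the partial sums form a Cauchy net and completeness
  applies.\<close>

lemma summable_on_orthogonal:
  fixes f :: "'i \<Rightarrow> 'a::{real_inner,banach}"
  assumes orth: "\<And>x y. x \<in> A \<Longrightarrow> y \<in> A \<Longrightarrow> x \<noteq> y \<Longrightarrow> inner (f x) (f y) = 0"
    and sq: "(\<lambda>x. (norm (f x))\<^sup>2) summable_on A"
  shows "f summable_on A"
proof -
  define L where "L = infsum (\<lambda>x. (norm (f x))\<^sup>2) A"
  have pyth: "(norm (sum f F))\<^sup>2 = (\<Sum>x\<in>F. (norm (f x))\<^sup>2)" if "finite F" "F \<subseteq> A" for F
    using that orth by (intro norm_sum_Pythagorean) (auto simp: pairwise_def orthogonal_def)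
  have bound: "(\<Sum>x\<in>F. (norm (f x))\<^sup>2) \<le> L" if "finite F" "F \<subseteq> A" for F
    unfolding L_def using that sq by (intro finite_sum_le_infsum) auto
  have "\<exists>P. eventually P (finite_subsets_at_top A) \<and>
              (\<forall>F F'. P F \<and> P F' \<longrightarrow> dist (sum f F) (sum f F') < \<epsilon>)" if "\<epsilon> > 0" for \<epsilon>
  proof -
    have "((\<lambda>x. (norm (f x))\<^sup>2) has_sum L) A"
      using sq by (simp add: L_def)
    moreover have "(\<epsilon>/2)\<^sup>2/2 > 0"
      using \<open>\<epsilon> > 0\<close> by simp
    ultimately obtain F0 where "finite F0" "F0 \<subseteq> A" "dist (\<Sum>x\<in>F0. (norm (f x))\<^sup>2) L \<le> (\<epsilon>/2)\<^sup>2/2"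
      by (rule exE[OF has_sum_finite_approximation]) blast
    with \<open>(\<epsilon>/2)\<^sup>2/2 > 0\<close>
    have F0: "finite F0" "F0 \<subseteq> A" "dist (\<Sum>x\<in>F0. (norm (f x))\<^sup>2) L < (\<epsilon>/2)\<^sup>2"
      by (blast, blast, linarith)
    have near: "dist (sum f F) (sum f F0) < \<epsilon>/2" if F: "finite F" "F0 \<subseteq> F" "F \<subseteq> A" for F
    proof -
      have "(dist (sum f F) (sum f F0))\<^sup>2 = (norm (sum f (F - F0)))\<^sup>2"
        using F by (simp add: dist_norm sum_diff)
      also have "\<dots> = (\<Sum>x\<in>F - F0. (norm (f x))\<^sup>2)"
        using F by (intro pyth) auto
      also have "\<dots> = (\<Sum>x\<in>F. (norm (f x))\<^sup>2) - (\<Sum>x\<in>F0. (norm (f x))\<^sup>2)"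
        using F by (simp add: sum_diff)
      also have "\<dots> < (\<epsilon>/2)\<^sup>2"
        using bound[of F] F F0(3) by (auto simp: dist_real_def)
      finally show ?thesis
        by (rule power_less_imp_less_base) (use \<open>\<epsilon> > 0\<close> in auto)
    qed
    have "dist (sum f F) (sum f F') < \<epsilon>"
      if "finite F \<and> F0 \<subseteq> F \<and> F \<subseteq> A" "finite F' \<and> F0 \<subseteq> F' \<and> F' \<subseteq> A" for F F'
      using near[of F] near[of F'] that by (meson dist_triangle_half_l)
    moreover have "eventually (\<lambda>F. finite F \<and> F0 \<subseteq> F \<and> F \<subseteq> A) (finite_subsets_at_top A)"
      unfolding eventually_finite_subsets_at_top using F0 by blast
    ultimately show ?thesis
      by (intro exI[of _ "\<lambda>F. finite F \<and> F0 \<subseteq> F \<and> F \<subseteq> A"] conjI allI impI) simp_all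
  qed
  then have "cauchy_filter (filtermap (sum f) (finite_subsets_at_top A))"
    by (simp add: cauchy_filter_metric_filtermap)
  moreover have "complete (UNIV::'a set)"
    by (meson Cauchy_convergent UNIV_I complete_def convergent_def)
  ultimately obtain L' where "(sum f \<longlongrightarrow> L') (finite_subsets_at_top A)"
    using complete_uniform[where S=UNIV] by (force simp add: filterlim_def)
  then show ?thesis
    using summable_on_def has_sum_def by blast
qed

lemma orthonormal_norm_sum:
  assumes "orthonormal E" "finite F" "F \<subseteq> E"
  shows "(norm (\<Sum>e\<in>F. scaleC (c e) e))\<^sup>2 = (\<Sum>e\<in>F. (cmod (c e))\<^sup>2)"
proof -
  have "(norm (\<Sum>e\<in>F. scaleC (c e) e))\<^sup>2 = (\<Sum>e\<in>F. (norm (scaleC (c e) e))\<^sup>2)"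
    using assms by (intro norm_sum_Pythagorean)
      (auto simp: pairwise_def orthogonal_def inner_eq_Re_cinner cinner_scaleC_left cinner_scaleC_right
        orthonormal_def subset_iff)
  also have "\<dots> = (\<Sum>e\<in>F. (cmod (c e))\<^sup>2)"
    using assms by (intro sum.cong) (auto simp: norm_scaleC orthonormal_def)
  finally show ?thesis .
qed

lemma norm_diff_square:
  "(norm (x - y))\<^sup>2 = (norm x)\<^sup>2 - 2 * inner x y + (norm (y::'a::real_inner))\<^sup>2"
  by (simp add: power2_norm_eq_inner inner_diff_left inner_diff_right inner_commute)

lemma Bessel_finite:
  assumes "orthonormal E" "finite F" "F \<subseteq> E"
  shows "(\<Sum>e\<in>F. (cmod (cinner x e))\<^sup>2) \<le> (norm x)\<^sup>2"
proof -
  define y where "y = (\<Sum>e\<in>F. scaleC (cinner x e) e)"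
  have "cinner x y = (\<Sum>e\<in>F. complex_of_real ((cmod (cinner x e))\<^sup>2))"
    unfolding y_def cinner.sum_right cinner_scaleC_right
    by (simp only: complex_norm_square mult.commute)
  then have xy: "inner x y = (\<Sum>e\<in>F. (cmod (cinner x e))\<^sup>2)"
    by (simp add: inner_eq_Re_cinner)
  have "0 \<le> (norm (x - y))\<^sup>2"
    by simp
  also have "\<dots> = (norm x)\<^sup>2 - 2 * inner x y + (norm y)\<^sup>2"
    by (rule norm_diff_square)
  finally show ?thesis
    using orthonormal_norm_sum[OF assms, of "cinner x"] xy by (simp add: y_def)
qed

lemma summable_on_real_bounded:
  fixes f :: "'i \<Rightarrow> real"
  assumes "\<And>x. x \<in> A \<Longrightarrow> 0 \<le> f x" "\<And>F. finite F \<Longrightarrow> F \<subseteq> A \<Longrightarrow> sum f F \<le> C"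
  shows "f summable_on A"
  using assms by (intro nonneg_bdd_above_summable_on bdd_aboveI2[of _ _ C]) auto

lemma Bessel_summable:
  assumes "orthonormal E"
  shows "(\<lambda>e. (cmod (cinner x e))\<^sup>2) summable_on E"
  using Bessel_finite[OF assms, of _ x] by (intro summable_on_real_bounded) auto

text \<open>Riesz-Fischer: the terms are orthogonal with summable squared norms, so the series
  converges, and continuity of \<open>cinner\<close> reads off the coefficients. Vectors with
  prescribed coefficients are produced in this way for Riesz representers and for diagonal
  operators.\<close>

lemma orthonormal_series:
  assumes E: "orthonormal E" and c: "(\<lambda>e. (cmod (c e))\<^sup>2) summable_on E"
  obtains y where "((\<lambda>e. scaleC (c e) e) has_sum y) E" "\<And>e. e \<in> E \<Longrightarrow> cinner y e = c e"
proof -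
  have "(\<lambda>e. (norm (scaleC (c e) e))\<^sup>2) summable_on E"
    by (rule iffD1[OF summable_on_cong c]) (use E in \<open>auto simp: norm_scaleC orthonormal_def\<close>)
  then have "(\<lambda>e. scaleC (c e) e) summable_on E"
    by (rule summable_on_orthogonal[rotated])
      (use E in \<open>auto simp: inner_eq_Re_cinner cinner_scaleC_left cinner_scaleC_right orthonormal_def\<close>)
  then obtain y where y: "((\<lambda>e. scaleC (c e) e) has_sum y) E"
    using summable_on_def by blast
  have "cinner y e = c e" if "e \<in> E" for e
  proof (rule has_sum_unique)
    show "((\<lambda>e'. cinner (scaleC (c e') e') e) has_sum cinner y e) E"
      using has_sum_bounded_linear[OF cinner.bounded_linear_left[of e] y] .
    show "((\<lambda>e'. cinner (scaleC (c e') e') e) has_sum c e) E"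
      by (rule has_sum_finite_neutralI[of "{e}"])
        (use that in \<open>auto simp: cinner_scaleC_left orthonormal_cinner[OF E]\<close>)
  qed
  with y that show ?thesis by blast
qed

lemma basis_expansion:
  assumes "orthonormal_basis E"
  shows "((\<lambda>e. scaleC (cinner x e) e) has_sum x) E"
proof -
  have E: "orthonormal E"
    using assms by (simp add: orthonormal_basis_iff)
  obtain y where y: "((\<lambda>e. scaleC (cinner x e) e) has_sum y) E"
    and "\<And>e. e \<in> E \<Longrightarrow> cinner y e = cinner x e"
    using orthonormal_series[OF E Bessel_summable[OF E]] by blast
  then have "\<forall>e\<in>E. cinner (x - y) e = 0"
    by (simp add: cinner.diff_left)
  then have "x = y"
    using assms by (auto simp: orthonormal_basis_iff)
  then show ?thesis using y by simp
qed

lemma bounded_clinear_D: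
  assumes "bounded_clinear T"
  shows "bounded_linear T" "T (scaleC c x) = scaleC c (T x)"
  using assms by (auto simp: bounded_clinear_def)

lemma bounded_clinear_expansion:
  assumes "bounded_clinear T" "orthonormal_basis E"
  shows "((\<lambda>e. scaleC (cinner x e) (T e)) has_sum T x) E"
  using has_sum_bounded_linear[OF bounded_clinear_D(1)[OF assms(1)] basis_expansion[OF assms(2)], of x]
  by (simp add: bounded_clinear_D(2)[OF assms(1)])

lemma bounded_clinear_eqI:
  assumes "bounded_clinear S" "bounded_clinear T" "orthonormal_basis E" "\<And>e. e \<in> E \<Longrightarrow> S e = T e"
  shows "S = T"
proof
  fix x
  have "((\<lambda>e. scaleC (cinner x e) (T e)) has_sum S x) E"
    by (rule iffD1[OF has_sum_cong bounded_clinear_expansion[OF assms(1,3)]]) (simp add: assms(4))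
  then show "S x = T x"
    using bounded_clinear_expansion[OF assms(2,3)] has_sum_unique by blast
qed

lemma Parseval_cinner:
  assumes "orthonormal_basis E"
  shows "((\<lambda>e. cinner x e * cinner e y) has_sum cinner x y) E"
  using has_sum_bounded_linear[OF cinner.bounded_linear_left[of y] basis_expansion[OF assms, of x]]
  by (simp add: cinner_scaleC_left)

lemma Parseval:
  assumes "orthonormal_basis E"
  shows "((\<lambda>e. (cmod (cinner x e))\<^sup>2) has_sum (norm x)\<^sup>2) E"
  using has_sum_Re[OF Parseval_cinner[OF assms, of x x]]
  by (simp add: cinner_mult_commute cinner_self)

text \<open>Zorn's lemma relative to a set \<open>V\<close>: \<open>V = UNIV\<close> leads to
  orthonormal bases, and a \<open>V\<close> made of eigenvectors leads to eigenbases.\<close>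

lemma maximal_orthonormal_subset:
  obtains E where "E \<subseteq> V" "orthonormal E" 
    "\<And>x. x \<in> V \<Longrightarrow> norm x = 1 \<Longrightarrow> \<exists>e\<in>E. cinner x e \<noteq> 0"
proof -
  have "\<exists>M\<in>{E. E \<subseteq> V \<and> orthonormal E}. \<forall>X\<in>{E. E \<subseteq> V \<and> orthonormal E}. M \<subseteq> X \<longrightarrow> X = M"
  proof (rule subset_Zorn')
    fix C assume C: "subset.chain {E. E \<subseteq> V \<and> orthonormal E} C"
    then have sub: "C \<subseteq> {E. E \<subseteq> V \<and> orthonormal E}"
      by (simp add: subset.chain_def)
    have "cinner e f = 0" if ef: "e \<in> \<Union>C" "f \<in> \<Union>C" "e \<noteq> f" for e f
    proof -
      obtain X Y where "X \<in> C" "Y \<in> C" "e \<in> X" "f \<in> Y"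
        using ef by blast
      moreover have "X \<subseteq> Y \<or> Y \<subseteq> X"
        using subset.chain_total[OF C \<open>X \<in> C\<close> \<open>Y \<in> C\<close>] by blast
      ultimately obtain Z where "Z \<in> C" "e \<in> Z" "f \<in> Z"
        by blast
      then show ?thesis
        using sub \<open>e \<noteq> f\<close> by (auto simp: orthonormal_def)
    qed
    moreover have "norm e = 1" if "e \<in> \<Union>C" for e
      using that sub by (auto simp: orthonormal_def)
    ultimately have "orthonormal (\<Union>C)"
      by (simp add: orthonormal_def)
    moreover have "\<Union>C \<subseteq> V"
      using sub by auto
    ultimately show "\<Union>C \<in> {E. E \<subseteq> V \<and> orthonormal E}"
      by simp
  qed
  then obtain E where "E \<in> {E. E \<subseteq> V \<and> orthonormal E}"
    and "\<forall>X\<in>{E. E \<subseteq> V \<and> orthonormal E}. E \<subseteq> X \<longrightarrow> X = E" ..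
  then have E: "E \<subseteq> V" "orthonormal E"
    and max: "\<And>X. X \<subseteq> V \<Longrightarrow> orthonormal X \<Longrightarrow> E \<subseteq> X \<Longrightarrow> X = E"
    by auto
  have "\<exists>e\<in>E. cinner x e \<noteq> 0" if x: "x \<in> V" "norm x = 1" for x
  proof (rule ccontr)
    assume "\<not> ?thesis"
    then have orth: "\<forall>e\<in>E. cinner x e = 0 \<and> cinner e x = 0"
      using cinner_eq_0_commute[of x] by blast
    then have "orthonormal (insert x E)"
      using E(2) x(2) by (auto simp: orthonormal_def)
    then have "x \<in> E"
      using max[of "insert x E"] E(1) x(1) by blast
    then show False
      using orth x(2) by (auto simp: cinner_self)
  qed
  with E that show ?thesis by blast
qed

lemma orthonormal_basis_exists: "\<exists>E::'a::chilbert_space set. orthonormal_basis E"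
proof -
  obtain E :: "'a set" where E: "orthonormal E"
    and max: "\<And>x. norm x = 1 \<Longrightarrow> \<exists>e\<in>E. cinner x e \<noteq> 0"
    using maximal_orthonormal_subset[of UNIV] by auto
  have "x = 0" if "\<forall>e\<in>E. cinner x e = 0" for x
  proof (rule ccontr)
    assume "x \<noteq> 0"
    then have "norm (x /\<^sub>R norm x) = 1"
      by simp
    then obtain e where "e \<in> E" "cinner (x /\<^sub>R norm x) e \<noteq> 0"
      using max by blast
    then show False
      using that by (simp add: cinner.scaleR_left)
  qed
  then show ?thesis
    using E orthonormal_basis_iff by blast
qed

section \<open>Riesz representation and adjoints\<close>

lemma Riesz_representation:
  fixes f :: "'a::chilbert_space \<Rightarrow> complex"
  assumes f: "bounded_linear f" and fC: "\<And>c x. f (scaleC c x) = c * f x"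
  shows "\<exists>z. \<forall>x. f x = cinner x z"
proof -
  interpret bounded_linear f by (rule f)
  obtain E :: "'a set" where basis: "orthonormal_basis E"
    using orthonormal_basis_exists by blast
  then have E: "orthonormal E"
    by (simp add: orthonormal_basis_iff)
  obtain K where K: "\<And>x. norm (f x) \<le> norm x * K" "K > 0"
    using pos_bounded by blast
  have bound: "(\<Sum>e\<in>F. (cmod (f e))\<^sup>2) \<le> K\<^sup>2" if F: "finite F" "F \<subseteq> E" for F
  proof -
    define s where "s = (\<Sum>e\<in>F. (cmod (f e))\<^sup>2)"
    \<comment> \<open>\<open>y\<close> is the truncation to \<open>F\<close> of the only possible
      representing vector. Testing \<open>f\<close> on it gives
      \<open>(norm y)^2 = f y \<le> norm y * K\<close>, hence a bound on the coefficients that is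
      uniform in \<open>F\<close>.\<close>
    define y where "y = (\<Sum>e\<in>F. scaleC (cnj (f e)) e)"
    have s0: "s \<ge> 0"
      by (simp add: s_def sum_nonneg)
    have y: "(norm y)\<^sup>2 = s"
      unfolding y_def s_def using orthonormal_norm_sum[OF E F, of "\<lambda>e. cnj (f e)"] by simp
    have "f y = (\<Sum>e\<in>F. complex_of_real ((cmod (f e))\<^sup>2))"
      unfolding y_def sum fC by (simp only: complex_norm_square mult.commute)
    then have "f y = complex_of_real s"
      by (simp add: s_def)
    then have "s \<le> norm y * K"
      using K(1)[of y] s0 by simp
    then have "norm y * norm y \<le> norm y * K"
      using y by (simp add: power2_eq_square)
    then have "norm y \<le> K"
      using K(2) by (smt (verit) mult_le_cancel_left norm_ge_zero)
    then show ?thesis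
      using y by (metis norm_ge_zero power_mono s_def)
  qed
  have "(\<lambda>e. (cmod (cnj (f e)))\<^sup>2) summable_on E"
    using bound by (intro summable_on_real_bounded[of _ _ "K\<^sup>2"]) auto
  then obtain z where "\<And>e. e \<in> E \<Longrightarrow> cinner z e = cnj (f e)"
    using orthonormal_series[OF E, of "\<lambda>e. cnj (f e)"] by blast
  then have z: "cinner e z = f e" if "e \<in> E" for e
    using that by (metis cinner_commute complex_cnj_cnj)
  have "f x = cinner x z" for x
  proof (rule has_sum_unique)
    show "((\<lambda>e. cinner x e * f e) has_sum f x) E"
      using has_sum_bounded_linear[OF f basis_expansion[OF basis], of x] by (simp add: fC)
    show "((\<lambda>e. cinner x e * f e) has_sum cinner x z) E"
      by (rule iffD1[OF has_sum_cong Parseval_cinner[OF basis]]) (simp add: z)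
  qed
  then show ?thesis by blast
qed

lemma cadjoint_eqI:
  assumes S: "\<And>x y. cinner (T x) y = cinner x (S y)"
  shows "cadjoint T = S"
  unfolding cadjoint_def
proof (rule the_equality)
  fix S' assume S': "\<forall>x y. cinner (T x) y = cinner x (S' y)"
  show "S' = S"
  proof (rule ext, rule cinner_eqI)
    fix y z
    show "cinner z (S' y) = cinner z (S y)"
      using S[of z y] S'[rule_format, of z y] by simp
  qed
qed (use S in simp)

lemma cinner_cadjoint:
  assumes T: "bounded_clinear T"
  shows "cinner (T x) y = cinner x (cadjoint T y)"
proof -
  have "\<exists>z. \<forall>x. cinner (T x) y = cinner x z" for y
  proof (rule Riesz_representation)
    show "bounded_linear (\<lambda>x. cinner (T x) y)"
      by (rule bounded_linear_compose[OF cinner.bounded_linear_left bounded_clinear_D(1)[OF T]])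
  qed (simp add: bounded_clinear_D(2)[OF T] cinner_scaleC_left)
  then obtain S where S: "\<And>x y. cinner (T x) y = cinner x (S y)"
    by metis
  then have "cadjoint T = S"
    by (rule cadjoint_eqI)
  then show ?thesis
    by (simp only: S)
qed

lemma cinner_cadjoint_left:
  assumes "bounded_clinear T"
  shows "cinner (cadjoint T x) y = cinner x (T y)"
  using arg_cong[OF cinner_cadjoint[OF assms, of y x], of cnj] by (simp add: cinner_commute[symmetric])

lemma bounded_clinear_cadjoint:
  assumes T: "bounded_clinear T"
  shows "bounded_clinear (cadjoint T)"
proof -
  note adj = cinner_cadjoint[OF T, symmetric]
  obtain K where K: "\<And>x. norm (T x) \<le> norm x * K" "K > 0"
    using bounded_linear.pos_bounded[OF bounded_clinear_D(1)[OF T]] by blast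
  have "norm (cadjoint T y) \<le> norm y * K" for y
  proof -
    have "(norm (cadjoint T y))\<^sup>2 = inner (T (cadjoint T y)) y"
      by (simp only: inner_eq_Re_cinner cinner_cadjoint[OF T] cinner_self Re_complex_of_real)
    also have "\<dots> \<le> norm (cadjoint T y) * K * norm y"
      using norm_cauchy_schwarz[of "T (cadjoint T y)" y] K(1)[of "cadjoint T y"]
      by (meson mult_right_mono norm_ge_zero order_trans)
    finally have "norm (cadjoint T y) * norm (cadjoint T y) \<le> norm (cadjoint T y) * (norm y * K)"
      by (simp add: power2_eq_square mult_ac)
    then show ?thesis
      using K(2) by (smt (verit) mult_le_cancel_left norm_ge_zero mult_nonneg_nonneg)
  qed
  moreover have "cadjoint T (x + y) = cadjoint T x + cadjoint T y" for x y
    by (rule cinner_eqI) (simp add: adj cinner.add_right)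
  moreover have C: "cadjoint T (scaleC c x) = scaleC c (cadjoint T x)" for c x
    by (rule cinner_eqI) (simp add: adj cinner_scaleC_right)
  moreover have "cadjoint T (r *\<^sub>R x) = r *\<^sub>R cadjoint T x" for r x
    using C[of "complex_of_real r"] by (simp add: scaleC_of_real)
  ultimately show ?thesis
    unfolding bounded_clinear_def by (auto intro!: bounded_linear_intro[of _ K])
qed

subsection \<open>The spectral theorem for compact positive operators\<close>

text \<open>Polarization: realness of the form at \<open>x + y\<close> settles the imaginary part,
  and the same identity with \<open>scaleC \<i> x\<close> in place of \<open>x\<close> settles the
  real part.\<close>

lemma positive_operator_selfadjoint:
  assumes T: "positive_operator T"
  shows "cinner (T x) y = cinner x (T y)"
proof -
  have bc: "bounded_clinear T" and real: "Im (cinner (T x) x) = 0" for x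
    using T by (auto simp: positive_operator_def complex_is_Real_iff)
  have add: "T (x + y) = T x + T y" for x y
    using bounded_clinear_D(1)[OF bc] by (rule linear_add[OF bounded_linear.linear])
  have sym: "Im (cinner (T x) y + cinner (T y) x) = 0" for x y
    using real[of "x + y"] real[of x] real[of y]
    by (simp add: add cinner.add_left cinner.add_right)
  have "Im (cinner (T x) y + cinner (T y) x) = 0"
    by (rule sym)
  moreover have "Re (cinner (T x) y - cinner (T y) x) = 0"
    using sym[of "scaleC \<i> x" y]
    by (simp add: bounded_clinear_D(2)[OF bc] cinner_scaleC_left cinner_scaleC_right)
  ultimately have "cinner (T x) y = cnj (cinner (T y) x)"
    by (simp add: complex_eq_iff)
  then show ?thesis
    by (simp only: cinner_commute[symmetric])
qed

text \<open>Let \<open>m\<close> be the norm of \<open>T\<close> on \<open>K\<close>. Along a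
  maximizing sequence the images converge, by compactness, to some \<open>y\<close> with
  \<open>T (T y) = m^2 y\<close>; positivity of \<open>T\<close> then permits a passage from
  \<open>T^2\<close> to \<open>T\<close>. The invariant subspace \<open>K\<close> is there so that
  the result applies to the orthogonal complement of eigenvectors already found.\<close>

lemma compact_positive_eigenvector:
  assumes T: "positive_operator T" and comp: "compact_operator T"
    and K: "subspace K" "closed K" and TK: "\<And>x. x \<in> K \<Longrightarrow> T x \<in> K"
    and x0: "x0 \<in> K" "x0 \<noteq> 0"
  shows "\<exists>x\<in>K. norm x = 1 \<and> (\<exists>t\<ge>0. T x = t *\<^sub>R x)"
proof -
  have bl: "bounded_linear T"
    using T by (auto simp: positive_operator_def bounded_clinear_def)
  interpret T: bounded_linear T by (rule bl)
  have normalize: ?thesis if "w \<in> K" "w \<noteq> 0" "t \<ge> 0" "T w = t *\<^sub>R w" for w t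
  proof (intro bexI[of _ "w /\<^sub>R norm w"] conjI exI[of _ t])
    show "T (w /\<^sub>R norm w) = t *\<^sub>R (w /\<^sub>R norm w)"
      using that by (simp add: T.scaleR)
  qed (use that subspace_scale[OF K(1)] in auto)
  show ?thesis
  proof (cases "\<forall>x\<in>K. T x = 0")
    case True
    then show ?thesis
      using normalize[of x0 0] x0 by simp
  next
    case False
    then obtain x1 where x1: "x1 \<in> K" "T x1 \<noteq> 0"
      by blast
    define N where "N = (\<lambda>x. norm (T x)) ` (K \<inter> cball 0 1)"
    define m where "m = Sup N"
    obtain C where C: "\<And>x. norm (T x) \<le> norm x * C" "C > 0"
      using T.pos_bounded by blast
    have bdd: "bdd_above N"
    proof (rule bdd_aboveI)
      fix r assume "r \<in> N"
      then obtain x where "norm x \<le> 1" "r = norm (T x)"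
        by (auto simp: N_def)
      moreover have "norm x * C \<le> 1 * C"
        using \<open>norm x \<le> 1\<close> C(2) by (intro mult_right_mono) auto
      ultimately show "r \<le> C"
        using C(1)[of x] by simp
    qed
    have "0 \<in> K"
      using K(1) by (rule subspace_0)
    then have ne: "N \<noteq> {}"
      by (auto simp: N_def)
    have norm_T: "norm (T x) \<le> m * norm x" if "x \<in> K" for x
    proof (cases "x = 0")
      case True
      then show ?thesis by (simp add: T.zero)
    next
      case False
      have "x /\<^sub>R norm x \<in> K \<inter> cball 0 1"
        using that subspace_scale[OF K(1)] False by auto
      then have "norm (T (x /\<^sub>R norm x)) \<le> m"
        unfolding m_def N_def by (intro cSup_upper[OF _ bdd[unfolded N_def]]) blast
      then show ?thesis
        using False by (simp add: T.scaleR field_simps)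
    qed
    have "x1 \<noteq> 0"
      using x1 T.zero by metis
    then have m_pos: "m > 0"
      using norm_T[OF x1(1)] x1(2)
      by (smt (verit) mult_nonpos_nonneg norm_ge_zero zero_less_norm_iff)
    have "\<exists>x\<in>K \<inter> cball 0 1. m - 1 / Suc n < norm (T x)" for n
      using less_cSup_iff[OF ne bdd, of "m - 1 / Suc n"] by (simp add: m_def N_def)
    then obtain u where u: "\<And>n. u n \<in> K" "\<And>n. norm (u n) \<le> 1"
      and u_lim: "\<And>n. m - 1 / Suc n < norm (T (u n))"
      by (metis IntE mem_cball_0)
    have "compact (closure (T ` cball 0 1))"
      using comp by (simp add: compact_operator_def)
    moreover have "\<forall>n. T (u n) \<in> closure (T ` cball 0 1)"
      using u(2) by (auto intro!: subsetD[OF closure_subset])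
    ultimately obtain y r where r: "strict_mono r" and y: "((\<lambda>n. T (u n)) \<circ> r) \<longlonglongrightarrow> y"
      unfolding compact_def by metis
    define v where "v = u \<circ> r"
    have v: "v n \<in> K" "norm (v n) \<le> 1" "norm (T (v n)) \<le> m" for n
    proof -
      show "v n \<in> K" "norm (v n) \<le> 1"
        using u by (auto simp: v_def)
      then have "m * norm (v n) \<le> m * 1"
        using m_pos by (intro mult_left_mono) auto
      then show "norm (T (v n)) \<le> m"
        using norm_T[of "v n"] \<open>v n \<in> K\<close> by simp
    qed
    have Tv: "(\<lambda>n. T (v n)) \<longlonglongrightarrow> y"
      using y by (simp add: v_def o_def)
    have "(\<lambda>n. m - 1 / Suc n) \<longlonglongrightarrow> m - 0"
      by (intro tendsto_intros LIMSEQ_Suc lim_1_over_n)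
    then have lower: "(\<lambda>n. m - 1 / Suc n) \<longlonglongrightarrow> m"
      by simp
    have "norm (T (u n)) \<le> m" for n
      using norm_T[OF u(1)] u(2) m_pos by (smt (verit) mult_left_le)
    then have "(\<lambda>n. norm (T (u n))) \<longlonglongrightarrow> m"
      using u_lim by (intro tendsto_sandwich[OF _ _ lower tendsto_const] always_eventually allI) (auto intro: less_imp_le)
    then have norm_Tv: "(\<lambda>n. norm (T (v n))) \<longlonglongrightarrow> m"
      using LIMSEQ_subseq_LIMSEQ[OF _ r] by (fastforce simp: v_def o_def)
    then have norm_y: "norm y = m"
      using LIMSEQ_unique tendsto_norm[OF Tv] by blast
    have y_K: "y \<in> K"
      using closed_sequentially[OF K(2) _ Tv] TK v(1) by blast
    \<comment> \<open>The defect of \<open>v n\<close> as an eigenvector of \<open>T^2\<close> for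
      \<open>m^2\<close>. Expanding its square and bounding both \<open>norm (T (T (v n)))\<close>
      and \<open>norm (v n)\<close> from above leaves \<open>m^4 - m^2 * norm (T (v n))^2\<close>,
      which tends to \<open>0\<close>.\<close>
    define w where "w n = T (T (v n)) - m\<^sup>2 *\<^sub>R v n" for n
    have w_le: "(norm (w n))\<^sup>2 \<le> m ^ 4 - m\<^sup>2 * (norm (T (v n)))\<^sup>2" for n
    proof -
      have "inner (T (T (v n))) (v n) = (norm (T (v n)))\<^sup>2"
        by (simp add: inner_eq_Re_cinner positive_operator_selfadjoint[OF T, of "T (v n)"] cinner_self)
      then have "(norm (w n))\<^sup>2 = (norm (T (T (v n))))\<^sup>2 - 2 * m\<^sup>2 * (norm (T (v n)))\<^sup>2 + m ^ 4 * (norm (v n))\<^sup>2"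
        unfolding w_def norm_diff_square by (simp add: power_mult_distrib power4_eq_xxxx power2_eq_square)
      moreover have "(norm (T (T (v n))))\<^sup>2 \<le> (m * norm (T (v n)))\<^sup>2"
        using norm_T[OF TK[OF v(1)]] by (intro power_mono) auto
      moreover have "m ^ 4 * (norm (v n))\<^sup>2 \<le> m ^ 4 * 1"
        using v(2) by (intro mult_left_mono) (auto simp: power_le_one)
      ultimately show ?thesis
        by (simp add: power_mult_distrib)
    qed
    have "(\<lambda>n. m ^ 4 - m\<^sup>2 * (norm (T (v n)))\<^sup>2) \<longlonglongrightarrow> m ^ 4 - m\<^sup>2 * m\<^sup>2"
      by (intro tendsto_intros norm_Tv)
    then have "(\<lambda>n. m ^ 4 - m\<^sup>2 * (norm (T (v n)))\<^sup>2) \<longlonglongrightarrow> 0"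
      by (simp add: power4_eq_xxxx power2_eq_square)
    then have "(\<lambda>n. (norm (w n))\<^sup>2) \<longlonglongrightarrow> 0"
      by (rule tendsto_sandwich[OF _ _ tendsto_const, rotated -1]) (use w_le in auto)
    then have "(\<lambda>n. sqrt ((norm (w n))\<^sup>2)) \<longlonglongrightarrow> sqrt 0"
      by (rule tendsto_real_sqrt)
    then have "w \<longlonglongrightarrow> 0"
      by (simp add: tendsto_norm_zero_iff)
    then have "(\<lambda>n. T (T (v n)) - w n) \<longlonglongrightarrow> T y - 0"
      by (intro tendsto_diff T.tendsto Tv)
    then have "(\<lambda>n. m\<^sup>2 *\<^sub>R v n) \<longlonglongrightarrow> T y"
      by (simp add: w_def)
    then have "(\<lambda>n. T (m\<^sup>2 *\<^sub>R v n)) \<longlonglongrightarrow> T (T y)"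
      by (rule T.tendsto)
    moreover have "(\<lambda>n. T (m\<^sup>2 *\<^sub>R v n)) \<longlonglongrightarrow> m\<^sup>2 *\<^sub>R y"
      unfolding T.scaleR by (intro tendsto_intros Tv)
    ultimately have TTy: "T (T y) = m\<^sup>2 *\<^sub>R y"
      by (rule LIMSEQ_unique)
    show ?thesis
    \<comment> \<open>As \<open>(T - m) (T + m) y = 0\<close>, the vector \<open>(T + m) y\<close>
      is an eigenvector for \<open>m\<close> once it is nonzero; its inner product with
      \<open>y\<close> is at least \<open>m * (norm y)^2 > 0\<close>.\<close>
    proof (rule normalize[of "T y + m *\<^sub>R y" m])
      show "T y + m *\<^sub>R y \<in> K"
        using y_K TK subspace_add[OF K(1)] subspace_scale[OF K(1)] by simp
      show "T (T y + m *\<^sub>R y) = m *\<^sub>R (T y + m *\<^sub>R y)"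
        by (simp add: T.add T.scaleR TTy scaleR_right_distrib power2_eq_square)
      have "inner (T y + m *\<^sub>R y) y = Re (cinner (T y) y) + m * (norm y)\<^sup>2"
        by (simp add: inner_add_left inner_eq_Re_cinner[of "T y"] power2_norm_eq_inner)
      moreover have "Re (cinner (T y) y) \<ge> 0"
        using T by (simp add: positive_operator_def)
      moreover have "m * (norm y)\<^sup>2 > 0"
        using m_pos norm_y by simp
      ultimately show "T y + m *\<^sub>R y \<noteq> 0"
        by auto
    qed (use m_pos in simp)
  qed
qed

text \<open>The substitute for a general functional calculus: roots, powers, multiples and products
  are computed on the eigenvalues \<open>l\<close>, whose values outside \<open>E\<close> are
  irrelevant.\<close>

definition diagonal :: "('a::chilbert_space \<Rightarrow> 'a) \<Rightarrow> 'a set \<Rightarrow> ('a \<Rightarrow> real) \<Rightarrow> bool" where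
  "diagonal T E l \<longleftrightarrow> bounded_clinear T \<and> orthonormal_basis E \<and> (\<forall>e\<in>E. T e = l e *\<^sub>R e)"

lemma diagonal_D:
  assumes "diagonal T E l"
  shows "bounded_clinear T" "orthonormal_basis E" "orthonormal E"
    "e \<in> E \<Longrightarrow> T e = l e *\<^sub>R e" "e \<in> E \<Longrightarrow> norm e = 1"
  using assms by (auto simp: diagonal_def orthonormal_basis_iff orthonormal_def)

text \<open>Take a maximal orthonormal set of eigenvectors. Its orthogonal complement is closed, is
  invariant by self-adjointness and contains no unit eigenvector, so
  \<open>compact_positive_eigenvector\<close> makes it trivial.\<close>

theorem compact_positive_diagonal:
  assumes T: "positive_operator T" and comp: "compact_operator T"
  obtains E l where "diagonal T E l" "\<And>e. e \<in> E \<Longrightarrow> 0 \<le> l e"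
proof -
  define V where "V = {x. \<exists>t\<ge>0. T x = t *\<^sub>R x}"
  obtain E where E: "E \<subseteq> V" "orthonormal E"
    and max: "\<And>x. x \<in> V \<Longrightarrow> norm x = 1 \<Longrightarrow> \<exists>e\<in>E. cinner x e \<noteq> 0"
    by (rule maximal_orthonormal_subset[of V]) blast
  define K where "K = (\<Inter>e\<in>E. {x. cinner x e = 0})"
  have "subspace K"
    by (auto simp: K_def subspace_def cinner.add_left cinner.scaleR_left cinner.zero_left)
  moreover have "closed K"
    unfolding K_def
    by (intro closed_INT ballI closed_Collect_eq continuous_intros
        linear_continuous_on cinner.bounded_linear_left)
  moreover have "T x \<in> K" if "x \<in> K" for x
  proof -
    have "cinner (T x) e = 0" if e: "e \<in> E" for e
    proof -
      obtain t where "T e = t *\<^sub>R e"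
        using E(1) e unfolding V_def by blast
      then show ?thesis
        using e \<open>x \<in> K\<close>
        by (simp add: positive_operator_selfadjoint[OF T] cinner.scaleR_right K_def)
    qed
    then show ?thesis
      by (simp add: K_def)
  qed
  ultimately have "x = 0" if "x \<in> K" for x
    using compact_positive_eigenvector[OF T comp _ _ _ that] max
    unfolding V_def K_def by blast
  then have basis: "orthonormal_basis E"
    using E(2) by (auto simp: orthonormal_basis_iff K_def)
  have "\<forall>e\<in>E. \<exists>t\<ge>0. T e = t *\<^sub>R e"
    using E(1) by (auto simp: V_def)
  then obtain l where "\<And>e. e \<in> E \<Longrightarrow> 0 \<le> l e \<and> T e = l e *\<^sub>R e"
    by metis
  then show ?thesis
    using that[of E l] T basis by (auto simp: diagonal_def positive_operator_def)
qed

section \<open>Calculus of operators that are diagonal in an orthonormal basis\<close>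

lemma diagonal_cinner:
  assumes "diagonal T E l" "e \<in> E"
  shows "cinner (T x) e = l e * cinner x e"
proof (rule has_sum_unique)
  note D = diagonal_D[OF assms(1)]
  show "((\<lambda>f. cinner (scaleC (cinner x f) (T f)) e) has_sum cinner (T x) e) E"
    using has_sum_bounded_linear[OF cinner.bounded_linear_left[of e] bounded_clinear_expansion[OF D(1,2), of x]] .
  show "((\<lambda>f. cinner (scaleC (cinner x f) (T f)) e) has_sum (l e * cinner x e)) E"
    by (rule has_sum_finite_neutralI[of "{e}"])
      (use assms(2) in \<open>auto simp: cinner_scaleC_left D(4) cinner.scaleR_left scaleR_conv_of_real
        orthonormal_cinner[OF D(3)]\<close>)
qed

lemma diagonal_form:
  assumes "diagonal T E l"
  shows "((\<lambda>e. l e * (cmod (cinner x e))\<^sup>2) has_sum Re (cinner (T x) x)) E"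
    and "Im (cinner (T x) x) = 0"
proof -
  note D = diagonal_D[OF assms(1)]
  have "((\<lambda>e. cinner (T x) e * cinner e x) has_sum cinner (T x) x) E"
    by (rule Parseval_cinner[OF D(2)])
  then have *: "((\<lambda>e. complex_of_real (l e * (cmod (cinner x e))\<^sup>2)) has_sum cinner (T x) x) E"
    by (rule iffD1[OF has_sum_cong, rotated])
      (simp add: diagonal_cinner[OF assms] mult.assoc cinner_mult_commute)
  show "((\<lambda>e. l e * (cmod (cinner x e))\<^sup>2) has_sum Re (cinner (T x) x)) E"
    using has_sum_Re[OF *] by simp
  show "Im (cinner (T x) x) = 0"
    using has_sum_Im[OF *] by (simp add: has_sum_0 has_sum_unique)
qed

lemma diagonal_bounded:
  assumes "diagonal T E l"
  obtains C where "C \<ge> 0" "\<And>e. e \<in> E \<Longrightarrow> \<bar>l e\<bar> \<le> C"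
proof -
  note D = diagonal_D[OF assms(1)]
  obtain C where C: "\<And>x. norm (T x) \<le> norm x * C" "C > 0"
    using bounded_linear.pos_bounded[OF bounded_clinear_D(1)[OF D(1)]] by blast
  have "\<bar>l e\<bar> \<le> C" if "e \<in> E" for e
    using C(1)[of e] D(4,5)[OF that] by simp
  with C(2) that[of C] show ?thesis by simp
qed

lemma diagonal_positive:
  assumes "diagonal T E l" "\<And>e. e \<in> E \<Longrightarrow> 0 \<le> l e"
  shows "positive_operator T"
  unfolding positive_operator_def
proof (intro conjI allI)
  fix x
  show "bounded_clinear T"
    using assms(1) by (rule diagonal_D)
  show "cinner (T x) x \<in> \<real>"
    using diagonal_form(2)[OF assms(1)] by (simp add: complex_is_Real_iff)
  show "0 \<le> Re (cinner (T x) x)"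
    using diagonal_form(1)[OF assms(1), of x] by (rule has_sum_nonneg) (simp add: assms(2))
qed

lemma basis_eqI:
  assumes "orthonormal_basis E" "\<And>e. e \<in> E \<Longrightarrow> cinner x e = cinner y e"
  shows "x = y"
  using assms by (metis orthonormal_basis_iff cinner.diff_left eq_iff_diff_eq_0)

text \<open>The image of \<open>x\<close> is defined by its coefficients
  \<open>g e * cinner x e\<close>, which are square-summable by domination with \<open>C\<close>.
  Linearity and boundedness are then checked on coefficients.\<close>

lemma diagonal_exists:
  assumes basis: "orthonormal_basis E" and g: "\<And>e. e \<in> E \<Longrightarrow> \<bar>g e\<bar> \<le> C"
  obtains S where "diagonal S E g"
proof -
  have E: "orthonormal E"
    using basis by (simp add: orthonormal_basis_iff)
  have le: "(cmod (g e * cinner x e))\<^sup>2 \<le> C\<^sup>2 * (cmod (cinner x e))\<^sup>2" if "e \<in> E" for x e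
    using power_mono[OF g[OF that], of 2]
    by (simp add: norm_mult power_mult_distrib mult_right_mono)
  have dom: "(\<lambda>e. C\<^sup>2 * (cmod (cinner x e))\<^sup>2) summable_on E" for x
    by (intro summable_on_cmult_right Bessel_summable[OF E])
  have summable: "(\<lambda>e. (cmod (g e * cinner x e))\<^sup>2) summable_on E" for x
    by (rule summable_on_comparison_test[OF dom]) (use le in auto)
  have "\<exists>y. \<forall>e\<in>E. cinner y e = g e * cinner x e" for x
    using orthonormal_series[OF E summable, of x] by metis
  then obtain S where S: "\<And>x e. e \<in> E \<Longrightarrow> cinner (S x) e = g e * cinner x e"
    by metis
  have add: "S (x + y) = S x + S y" for x y
    by (rule basis_eqI[OF basis]) (simp add: S cinner.add_left distrib_left)
  have C: "S (scaleC c x) = scaleC c (S x)" for c x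
    by (rule basis_eqI[OF basis]) (simp add: S cinner_scaleC_left)
  have "S (r *\<^sub>R x) = r *\<^sub>R S x" for r x
    using C[of "complex_of_real r"] by (simp add: scaleC_of_real)
  moreover have "norm (S x) \<le> norm x * \<bar>C\<bar>" for x
  proof -
    have "(norm (S x))\<^sup>2 \<le> C\<^sup>2 * (norm x)\<^sup>2"
    proof (rule has_sum_mono[OF Parseval[OF basis]])
      show "((\<lambda>e. C\<^sup>2 * (cmod (cinner x e))\<^sup>2) has_sum C\<^sup>2 * (norm x)\<^sup>2) E"
        by (intro has_sum_cmult_right Parseval[OF basis])
    qed (use le in \<open>simp add: S\<close>)
    also have "\<dots> = (norm x * \<bar>C\<bar>)\<^sup>2"
      by (simp add: power_mult_distrib)
    finally show ?thesis
      by (rule power2_le_imp_le) simp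
  qed
  ultimately have "bounded_clinear S"
    unfolding bounded_clinear_def using add C by (auto intro!: bounded_linear_intro[of _ "\<bar>C\<bar>"])
  moreover have "S e = g e *\<^sub>R e" if "e \<in> E" for e
    by (rule basis_eqI[OF basis]) (simp add: S cinner.scaleR_left scaleR_conv_of_real
        orthonormal_cinner[OF E that])
  ultimately show ?thesis
    using that[of S] basis by (simp add: diagonal_def)
qed

lemma diagonal_unique:
  assumes "diagonal S E g" "diagonal T E h" "\<And>e. e \<in> E \<Longrightarrow> g e = h e"
  shows "S = T"
  using assms by (intro bounded_clinear_eqI[of S T E]) (auto simp: diagonal_def)

lemma bounded_clinear_compose:
  assumes "bounded_clinear S" "bounded_clinear T"
  shows "bounded_clinear (S \<circ> T)"
  using assms bounded_linear_compose[of S T] by (simp add: bounded_clinear_def o_def)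

lemma diagonal_compose:
  assumes S: "diagonal S E g" and T: "diagonal T E h"
  shows "diagonal (S \<circ> T) E (\<lambda>e. g e * h e)"
  unfolding diagonal_def
proof (intro conjI ballI bounded_clinear_compose)
  note DS = diagonal_D[OF S] and DT = diagonal_D[OF T]
  show "bounded_clinear S" "bounded_clinear T" "orthonormal_basis E"
    by (rule DS DT)+
  show "(S \<circ> T) e = (g e * h e) *\<^sub>R e" if "e \<in> E" for e
    using linear_scale[OF bounded_linear.linear[OF bounded_clinear_D(1)[OF DS(1)]]] that
    by (simp add: DS(4) DT(4))
qed

text \<open>If \<open>T e = l e\<close> and \<open>S\<^sup>2 = T\<close>, then \<open>w = S e - \<surd>l e\<close> satisfies
  \<open>(S + \<surd>l) w = 0\<close>.\<close>

lemma positive_sqrt_eigenvector: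
  assumes S: "positive_operator S" and SS: "S (S e) = l *\<^sub>R e" and l: "0 \<le> l"
  shows "S e = sqrt l *\<^sub>R e"
proof -
  have bl: "bounded_linear S"
    using S by (auto simp: positive_operator_def bounded_clinear_def)
  interpret S: bounded_linear S by (rule bl)
  define w where "w = S e - sqrt l *\<^sub>R e"
  have "S w + sqrt l *\<^sub>R w = 0"
    using l by (simp add: w_def S.diff S.scaleR SS scaleR_right_diff_distrib)
  then have "inner (S w + sqrt l *\<^sub>R w) w = 0"
    by simp
  then have 0: "Re (cinner (S w) w) + sqrt l * (norm w)\<^sup>2 = 0"
    by (simp add: inner_add_left inner_eq_Re_cinner[of "S w"] power2_norm_eq_inner)
  moreover have "Re (cinner (S w) w) \<ge> 0"
    using S by (simp add: positive_operator_def)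
  ultimately have "sqrt l * (norm w)\<^sup>2 = 0"
    using l by (smt (verit) mult_nonneg_nonneg real_sqrt_ge_zero zero_le_power2)
  then consider "l = 0" | "w = 0"
    by auto
  then show ?thesis
  proof cases
    case 1
    have "(norm (S e))\<^sup>2 = Re (cinner (S (S e)) e)"
      by (simp only: positive_operator_selfadjoint[OF S, of "S e"] cinner_self Re_complex_of_real)
    then show ?thesis
      using 1 by (simp add: SS cinner.zero_left)
  next
    case 2
    then show ?thesis
      by (simp add: w_def)
  qed
qed

text \<open>The diagonal operator with entries \<open>sqrt (l e)\<close> is one positive root. For
  the uniqueness demanded by \<open>THE\<close>, any positive root \<open>R\<close> satisfies
  \<open>R (R e) = l e *\<^sub>R e\<close> and is thus determined on \<open>E\<close> by
  \<open>positive_sqrt_eigenvector\<close>.\<close>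

lemma diagonal_op_sqrt:
  assumes T: "diagonal T E l" and l: "\<And>e. e \<in> E \<Longrightarrow> 0 \<le> l e"
  shows "diagonal (op_sqrt T) E (\<lambda>e. sqrt (l e))"
proof -
  obtain C where C: "C \<ge> 0" "\<And>e. e \<in> E \<Longrightarrow> \<bar>l e\<bar> \<le> C"
    using diagonal_bounded[OF T] by blast
  obtain S where S: "diagonal S E (\<lambda>e. sqrt (l e))"
  proof (rule diagonal_exists[OF diagonal_D(2)[OF T]])
    fix e assume "e \<in> E"
    then show "\<bar>sqrt (l e)\<bar> \<le> sqrt C"
      using C(2) l by fastforce
  qed
  have "op_sqrt T = S"
    unfolding op_sqrt_def
  proof (rule the_equality, rule conjI)
    show "positive_operator S"
      using S by (rule diagonal_positive) (simp add: l)
    show "S \<circ> S = T"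
      using diagonal_compose[OF S S] T by (rule diagonal_unique) (simp add: l)
    fix R assume R: "positive_operator R \<and> R \<circ> R = T"
    show "R = S"
    proof (rule bounded_clinear_eqI[OF _ diagonal_D(1,2)[OF S]])
      show "bounded_clinear R"
        using R by (simp add: positive_operator_def)
      fix e assume e: "e \<in> E"
      have "R (R e) = l e *\<^sub>R e"
        using R diagonal_D(4)[OF T e] by (metis comp_apply)
      then show "R e = S e"
        using positive_sqrt_eigenvector R l[OF e] diagonal_D(4)[OF S e] by metis
    qed
  qed
  then show ?thesis
    using S by simp
qed

lemma diagonal_op_powr:
  assumes T: "diagonal T E l" and l: "\<And>e. e \<in> E \<Longrightarrow> 0 \<le> l e" and p: "p > 0"
  shows "diagonal (op_powr T p) E (\<lambda>e. l e powr p)"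
proof -
  obtain C where C: "C \<ge> 0" "\<And>e. e \<in> E \<Longrightarrow> \<bar>l e\<bar> \<le> C"
    using diagonal_bounded[OF T] by blast
  obtain S where S: "diagonal S E (\<lambda>e. l e powr p)"
  proof (rule diagonal_exists[OF diagonal_D(2)[OF T]])
    fix e assume "e \<in> E"
    then show "\<bar>l e powr p\<bar> \<le> C powr p"
      using C(2)[of e] l[of e] p by (simp add: powr_mono2)
  qed
  have "op_powr T p = S"
    unfolding op_powr_def
  proof (rule the_equality, intro conjI allI impI)
    show "bounded_clinear S"
      using S by (rule diagonal_D)
    fix t x assume t: "(t::real) \<ge> 0" "T x = t *\<^sub>R x"
    show "S x = (t powr p) *\<^sub>R x"
    proof (rule basis_eqI[OF diagonal_D(2)[OF T]])
      fix e assume e: "e \<in> E"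
      \<comment> \<open>The specification of \<open>op_powr\<close> speaks of all eigenvectors, not
        only those in \<open>E\<close>. Comparing coefficients shows that an eigenvector for
        \<open>t\<close> is supported on those \<open>e\<close> with \<open>l e = t\<close>.\<close>
      have "l e * cinner x e = t * cinner x e"
        using diagonal_cinner[OF T e, of x] by (simp only: t(2) cinner.scaleR_left scaleR_conv_of_real)
      then have "cinner x e = 0 \<or> l e = t"
        by simp
      then show "cinner (S x) e = cinner ((t powr p) *\<^sub>R x) e"
        by (auto simp: diagonal_cinner[OF S e] cinner.scaleR_left scaleR_conv_of_real)
    qed
  next
    fix R assume R: "bounded_clinear R \<and>
      (\<forall>t\<ge>0. \<forall>x. T x = t *\<^sub>R x \<longrightarrow> R x = (t powr p) *\<^sub>R x)"
    show "R = S"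
    proof (rule bounded_clinear_eqI[OF _ diagonal_D(1,2)[OF S]])
      fix e assume e: "e \<in> E"
      show "R e = S e"
        using R l[OF e] diagonal_D(4)[OF T e] diagonal_D(4)[OF S e] by simp
    qed (use R in simp)
  qed
  then show ?thesis
    using S by simp
qed

section \<open>Sums in \<open>ennreal\<close> and the trace in an arbitrary basis\<close>

lemma infsum_ennreal_has_sum:
  assumes "(f has_sum s) A" "\<And>x. x \<in> A \<Longrightarrow> 0 \<le> f x"
  shows "(\<Sum>\<^sub>\<infinity>x\<in>A. ennreal (f x)) = ennreal s"
proof -
  have "f summable_on A" "infsum f A = s"
    using assms(1) by (auto simp: has_sum_iff)
  then have "ennreal s = (SUP F\<in>{F. finite F \<and> F \<subseteq> A}. ennreal (sum f F))"
    using infsum_nonneg_is_SUPREMUM_ennreal[of f A] assms(2) by simp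
  also have "\<dots> = (SUP F\<in>{F. finite F \<and> F \<subseteq> A}. \<Sum>x\<in>F. ennreal (f x))"
    using assms(2) by (intro SUP_cong refl) (metis (mono_tags, lifting) mem_Collect_eq subsetD sum_ennreal)
  also have "\<dots> = (\<Sum>\<^sub>\<infinity>x\<in>A. ennreal (f x))"
    by (rule nonneg_infsum_complete[symmetric]) simp
  finally show ?thesis by simp
qed

lemma sum_infsum_ennreal:
  fixes f :: "'i \<Rightarrow> 'j \<Rightarrow> ennreal"
  shows "(\<Sum>i\<in>F. \<Sum>\<^sub>\<infinity>j\<in>B. f i j) = (\<Sum>\<^sub>\<infinity>j\<in>B. \<Sum>i\<in>F. f i j)"
  by (induction F rule: infinite_finite_induct) (simp_all add: infsum_add nonneg_summable_on_complete)

lemma finite_sum_le_infsum_ennreal: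
  fixes f :: "'i \<Rightarrow> ennreal"
  assumes "finite F" "F \<subseteq> A"
  shows "sum f F \<le> infsum f A"
proof -
  have "sum f F = infsum f F"
    using assms by simp
  also have "\<dots> \<le> infsum f A"
    using assms by (intro infsum_mono_neutral nonneg_summable_on_complete) auto
  finally show ?thesis .
qed

lemma infsum_swap_ennreal:
  fixes f :: "'i \<Rightarrow> 'j \<Rightarrow> ennreal"
  shows "(\<Sum>\<^sub>\<infinity>i\<in>A. \<Sum>\<^sub>\<infinity>j\<in>B. f i j) = (\<Sum>\<^sub>\<infinity>j\<in>B. \<Sum>\<^sub>\<infinity>i\<in>A. f i j)"
proof -
  have *: "(\<Sum>\<^sub>\<infinity>i\<in>A. \<Sum>\<^sub>\<infinity>j\<in>B. f i j) \<le> (\<Sum>\<^sub>\<infinity>j\<in>B. \<Sum>\<^sub>\<infinity>i\<in>A. f i j)"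
    for A :: "'k set" and B :: "'l set" and f :: "'k \<Rightarrow> 'l \<Rightarrow> ennreal"
  proof (rule infsum_le_finite_sums)
    fix F assume F: "finite F" "F \<subseteq> A"
    show "(\<Sum>i\<in>F. \<Sum>\<^sub>\<infinity>j\<in>B. f i j) \<le> (\<Sum>\<^sub>\<infinity>j\<in>B. \<Sum>\<^sub>\<infinity>i\<in>A. f i j)"
      unfolding sum_infsum_ennreal
    using F by (intro infsum_mono finite_sum_le_infsum_ennreal nonneg_summable_on_complete) auto
  qed (simp add: nonneg_summable_on_complete)
  show ?thesis
    by (rule antisym) (rule *)+
qed

lemma diagonal_form_infsum:
  assumes "diagonal T E l" "\<And>e. e \<in> E \<Longrightarrow> 0 \<le> l e"
  shows "ennreal (Re (cinner (T x) x)) = (\<Sum>\<^sub>\<infinity>e\<in>E. ennreal (l e * (cmod (cinner x e))\<^sup>2))"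
  by (rule infsum_ennreal_has_sum[OF diagonal_form(1)[OF assms(1)], symmetric]) (simp add: assms(2))

text \<open>Both sides are the double sum of \<open>l e * |<f, e>|^2\<close>: one order of summation
  gives the quadratic forms at \<open>f\<close>, the other is evaluated by Parseval's identity for
  \<open>e\<close> in the basis \<open>F\<close>.\<close>

lemma diagonal_trace:
  assumes T: "diagonal T E l" and l: "\<And>e. e \<in> E \<Longrightarrow> 0 \<le> l e" and F: "orthonormal_basis F"
  shows "(\<Sum>\<^sub>\<infinity>f\<in>F. ennreal (Re (cinner (T f) f))) = (\<Sum>\<^sub>\<infinity>e\<in>E. ennreal (l e))"
proof -
  have "(\<Sum>\<^sub>\<infinity>f\<in>F. ennreal (l e * (cmod (cinner f e))\<^sup>2)) = ennreal (l e)" if "e \<in> E" for e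
  proof -
    have "((\<lambda>f. l e * (cmod (cinner e f))\<^sup>2) has_sum l e * (norm e)\<^sup>2) F"
      by (intro has_sum_cmult_right Parseval F)
    then show ?thesis
      using diagonal_D(5)[OF T that] l[OF that] infsum_ennreal_has_sum
      by (force simp: cmod_cinner_commute[of _ e])
  qed
  then show ?thesis
    by (simp add: diagonal_form_infsum[OF T l] infsum_swap_ennreal[of _ E F] cong: infsum_cong)
qed

lemma diagonal_pos_trace:
  assumes "diagonal T E l" "\<And>e. e \<in> E \<Longrightarrow> 0 \<le> l e"
  shows "pos_trace T = (\<Sum>\<^sub>\<infinity>e\<in>E. ennreal (l e))"
  unfolding pos_trace_def using assms someI_ex[OF orthonormal_basis_exists] by (rule diagonal_trace)

subsection \<open>Jensen-type trace inequalities\<close>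

text \<open>Concavity: the right side is the tangent line of \<open>t \<mapsto> t powr q\<close> at
  \<open>y\<close>. It results from Young's inequality for \<open>x powr q * y powr (1 - q)\<close>
  after multiplication by \<open>y powr (q - 1)\<close>.\<close>

lemma powr_Bernoulli_le:
  fixes x y q :: real
  assumes "0 < q" "q \<le> 1" "0 \<le> x" "0 < y"
  shows "x powr q \<le> (1 - q) * y powr q + q * y powr (q - 1) * x"
proof (cases "x = 0")
  case True
  then show ?thesis using assms by simp
next
  case False
  have "x powr q * y powr (1 - q) \<le> q * x + (1 - q) * y"
    by (rule Youngs_inequality_0) (use assms False in auto)
  then have "x powr q * y powr (1 - q) * y powr (q - 1) \<le> (q * x + (1 - q) * y) * y powr (q - 1)"
    by (rule mult_right_mono) simp
  moreover have "y powr (1 - q) * y powr (q - 1) = 1"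
    using assms by (simp flip: powr_add)
  moreover have "y * y powr (q - 1) = y powr q"
    using assms by (simp add: powr_diff)
  ultimately show ?thesis
    by (simp add: algebra_simps)
qed

text \<open>Convexity puts the same tangent line below the graph. This time Young's inequality, with
  weights \<open>1 / q\<close> and \<open>1 - 1 / q\<close>, is applied to \<open>x powr q\<close>
  and \<open>y powr q\<close>.\<close>

lemma powr_Bernoulli_ge:
  fixes x y q :: real
  assumes q: "1 \<le> q" and "0 \<le> x" "0 < y"
  shows "(1 - q) * y powr q + q * y powr (q - 1) * x \<le> x powr q"
proof (cases "x = 0")
  case True
  then show ?thesis using assms by (simp add: mult_nonpos_nonneg)
next
  case False
  have "(x powr q) powr (1 / q) * (y powr q) powr (1 - 1 / q) \<le> 1 / q * x powr q + (1 - 1 / q) * y powr q"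
    by (rule Youngs_inequality_0) (use assms False in auto)
  moreover have "(x powr q) powr (1 / q) = x"
    using assms by (simp add: powr_powr)
  moreover have "(y powr q) powr (1 - 1 / q) = y powr (q - 1)"
    using assms by (simp add: powr_powr right_diff_distrib)
  ultimately have "x * y powr (q - 1) \<le> 1 / q * x powr q + (1 - 1 / q) * y powr q"
    by simp
  then have "q * (x * y powr (q - 1)) \<le> q * (1 / q * x powr q + (1 - 1 / q) * y powr q)"
    using q by (intro mult_left_mono) auto
  then show ?thesis
    using q by (simp add: algebra_simps)
qed

text \<open>Jensen's inequality for weights of total mass at most one: the missing mass may be placed at
  \<open>0\<close>, where \<open>t \<mapsto> t\<^sup>q\<close> vanishes.\<close>

context
  fixes w x :: "'i \<Rightarrow> real" and A :: "'i set" and q \<sigma> y z :: real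
  assumes w: "\<And>a. a \<in> A \<Longrightarrow> 0 \<le> w a" and x: "\<And>a. a \<in> A \<Longrightarrow> 0 \<le> x a"
    and \<sigma>: "(w has_sum \<sigma>) A" "\<sigma> \<le> 1"
    and y: "((\<lambda>a. w a * x a) has_sum y) A"
    and z: "((\<lambda>a. w a * x a powr q) has_sum z) A"
begin

lemma subprob_mean_nonneg: "0 \<le> y"
  using y by (rule has_sum_nonneg) (simp add: w x)

lemma subprob_tangent:
  "((\<lambda>a. w a * ((1 - q) * y powr q + q * y powr (q - 1) * x a)) has_sum
     ((1 - q) * y powr q * \<sigma> + q * y powr (q - 1) * y)) A"
  using has_sum_add[OF has_sum_cmult_right[OF \<sigma>(1), of "(1 - q) * y powr q"]
      has_sum_cmult_right[OF y, of "q * y powr (q - 1)"]]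
  by (simp add: algebra_simps)

lemma Jensen_powr_ge:
  assumes "1 \<le> q"
  shows "y powr q \<le> z"
proof (cases "y = 0")
  case True
  have "0 \<le> z"
    using z by (rule has_sum_nonneg) (simp add: w)
  with True show ?thesis by simp
next
  case False
  then have "y > 0"
    using subprob_mean_nonneg by simp
  \<comment> \<open>Summed against the weights, the tangent line gives
    \<open>((1 - q) * \<sigma> + q) * y powr q\<close>. As \<open>1 - q \<le> 0\<close>, a deficit
    \<open>1 - \<sigma>\<close> of mass can only raise this above \<open>y powr q\<close>.\<close>
  have "(q - 1) * \<sigma> \<le> (q - 1) * 1"
    using \<sigma>(2) assms by (intro mult_left_mono) auto
  then have "1 * y powr q \<le> ((1 - q) * \<sigma> + q) * y powr q"
    by (intro mult_right_mono) (auto simp: algebra_simps)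
  also have "\<dots> = (1 - q) * y powr q * \<sigma> + q * y powr (q - 1) * y"
    using \<open>y > 0\<close> by (simp add: powr_diff algebra_simps)
  also have "\<dots> \<le> z"
    using subprob_tangent z
    by (rule has_sum_mono) (intro mult_left_mono powr_Bernoulli_ge assms x w \<open>y > 0\<close>)
  finally show ?thesis by simp
qed

lemma Jensen_powr_le:
  assumes "0 < q" "q \<le> 1"
  shows "z \<le> y powr q"
proof (cases "y = 0")
  case True
  \<comment> \<open>For \<open>q < 1\<close> there is no finite tangent at \<open>0\<close>;
    instead, a zero mean of nonnegative terms makes every term vanish.\<close>
  have "w a * x a = 0" if "a \<in> A" for a
    using nonneg_has_sum_le_0D[OF y] True w x that by simp
  then have "((\<lambda>a. 0) has_sum z) A"
    by (intro iffD1[OF has_sum_cong z]) auto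
  then have "z = 0"
    using has_sum_unique has_sum_0_simp by blast
  with True show ?thesis by simp
next
  case False
  then have "y > 0"
    using subprob_mean_nonneg by simp
  have "z \<le> (1 - q) * y powr q * \<sigma> + q * y powr (q - 1) * y"
    using z subprob_tangent
    by (rule has_sum_mono) (intro mult_left_mono powr_Bernoulli_le assms x w \<open>y > 0\<close>)
  also have "\<dots> = ((1 - q) * \<sigma> + q) * y powr q"
    using \<open>y > 0\<close> by (simp add: powr_diff algebra_simps)
  also have "\<dots> \<le> 1 * y powr q"
  proof (intro mult_right_mono)
    have "(1 - q) * \<sigma> \<le> (1 - q) * 1"
      using \<sigma>(2) assms by (intro mult_left_mono) auto
    then show "(1 - q) * \<sigma> + q \<le> 1" by simp
  qed simp
  finally show ?thesis by simp
qed

end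

definition power_trace :: "real \<Rightarrow> ('a::chilbert_space \<Rightarrow> 'a) \<Rightarrow> ennreal" where
  "power_trace q T = pos_trace (op_powr T q)"

text \<open>An infinite trace yields the value \<open>0\<close> here, so estimates in terms of this
  quantity have to be accompanied by finiteness of \<open>power_trace\<close>.\<close>

definition power_norm :: "real \<Rightarrow> ('a::chilbert_space \<Rightarrow> 'a) \<Rightarrow> real" where
  "power_norm q T = enn2real (power_trace q T) powr (1 / q)"

lemma power_norm_nonneg: "0 \<le> power_norm q T"
  by (simp add: power_norm_def)

lemma power_norm_powr: "q > 0 \<Longrightarrow> power_norm q T powr q = enn2real (power_trace q T)"
  by (simp add: power_norm_def powr_powr)

context
  fixes T :: "'a::chilbert_space \<Rightarrow> 'a" and E l and q :: real
  assumes T: "diagonal T E l" and l: "\<And>e. e \<in> E \<Longrightarrow> 0 \<le> l e" and q: "q > 0"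
begin

lemma power_trace_diagonal: "power_trace q T = (\<Sum>\<^sub>\<infinity>e\<in>E. ennreal (l e powr q))"
  unfolding power_trace_def by (rule diagonal_pos_trace[OF diagonal_op_powr[OF T l q]]) auto

lemma power_trace_basis:
  assumes "orthonormal_basis F"
  shows "power_trace q T = (\<Sum>\<^sub>\<infinity>f\<in>F. ennreal (Re (cinner (op_powr T q f) f)))"
  unfolding power_trace_diagonal
  by (rule diagonal_trace[OF diagonal_op_powr[OF T l q] _ assms, symmetric]) auto

text \<open>As \<open>norm x = 1\<close>, the weights \<open>|<x, e>|^2\<close> are a probability
  distribution on the eigenvalues, with mean \<open><T x, x>\<close> and \<open>q\<close>-th moment
  \<open><T^q x, x>\<close>.\<close>

lemma Peierls_ge:
  assumes "1 \<le> q" "norm x = 1"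
  shows "Re (cinner (T x) x) powr q \<le> Re (cinner (op_powr T q x) x)"
proof (rule Jensen_powr_ge)
  show "((\<lambda>e. (cmod (cinner x e))\<^sup>2) has_sum (norm x)\<^sup>2) E"
    by (rule Parseval[OF diagonal_D(2)[OF T]])
  show "((\<lambda>e. (cmod (cinner x e))\<^sup>2 * l e) has_sum Re (cinner (T x) x)) E"
    using diagonal_form(1)[OF T, of x] by (simp add: mult.commute)
  show "((\<lambda>e. (cmod (cinner x e))\<^sup>2 * l e powr q) has_sum Re (cinner (op_powr T q x) x)) E"
    using diagonal_form(1)[OF diagonal_op_powr[OF T l q], of x] by (simp add: mult.commute)
qed (use assms l in auto)

lemma Peierls_le:
  assumes "q \<le> 1" "norm x = 1"
  shows "Re (cinner (op_powr T q x) x) \<le> Re (cinner (T x) x) powr q"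
proof (rule Jensen_powr_le)
  show "((\<lambda>e. (cmod (cinner x e))\<^sup>2) has_sum (norm x)\<^sup>2) E"
    by (rule Parseval[OF diagonal_D(2)[OF T]])
  show "((\<lambda>e. (cmod (cinner x e))\<^sup>2 * l e) has_sum Re (cinner (T x) x)) E"
    using diagonal_form(1)[OF T, of x] by (simp add: mult.commute)
  show "((\<lambda>e. (cmod (cinner x e))\<^sup>2 * l e powr q) has_sum Re (cinner (op_powr T q x) x)) E"
    using diagonal_form(1)[OF diagonal_op_powr[OF T l q], of x] by (simp add: mult.commute)
qed (use assms l q in auto)

lemma Peierls_trace_ge:
  assumes "1 \<le> q" "orthonormal_basis F"
  shows "(\<Sum>\<^sub>\<infinity>f\<in>F. ennreal (Re (cinner (T f) f) powr q)) \<le> power_trace q T"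
  unfolding power_trace_basis[OF assms(2)]
  by (intro infsum_mono nonneg_summable_on_complete ennreal_leI Peierls_ge)
    (use assms in \<open>auto simp: orthonormal_basis_def\<close>)

lemma Peierls_trace_le:
  assumes "q \<le> 1" "orthonormal_basis F"
  shows "power_trace q T \<le> (\<Sum>\<^sub>\<infinity>f\<in>F. ennreal (Re (cinner (T f) f) powr q))"
  unfolding power_trace_basis[OF assms(2)]
  by (intro infsum_mono nonneg_summable_on_complete ennreal_leI Peierls_le)
    (use assms in \<open>auto simp: orthonormal_basis_def\<close>)

end

text \<open>For \<open>0 \<le> S \<le> R\<close> with eigenvalues \<open>s\<^sub>e\<close> and \<open>m\<^sub>f\<close>, the matrix
  \<open>w\<^sub>e\<^sub>f = s\<^sub>e \<bar>\<langle>e, f\<rangle>\<bar>\<^sup>2 / m\<^sub>f\<close> has row sums at most one, and it maps the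
  eigenvalues of \<open>R\<close> to those of \<open>S\<close>.\<close>

context
  fixes S R :: "'a::chilbert_space \<Rightarrow> 'a" and E F s m
  assumes S: "diagonal S E s" and s: "\<And>e. e \<in> E \<Longrightarrow> 0 \<le> s e"
    and R: "diagonal R F m" and m: "\<And>f. f \<in> F \<Longrightarrow> 0 \<le> m f"
    and SR: "\<And>x. Re (cinner (S x) x) \<le> Re (cinner (R x) x)"
begin

text \<open>The left side is a single term of the expansion of \<open><S x, x>\<close>: the rank-one
  part of \<open>S\<close> at \<open>e\<close> lies below \<open>S\<close>, hence below
  \<open>R\<close>.\<close>

lemma eigenvalue_form_le:
  assumes "e \<in> E"
  shows "s e * (cmod (cinner x e))\<^sup>2 \<le> Re (cinner (R x) x)"
proof -
  have "sum (\<lambda>e. s e * (cmod (cinner x e))\<^sup>2) {e} \<le> Re (cinner (S x) x)"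
    by (rule finite_sum_le_has_sum[OF diagonal_form(1)[OF S]]) (use assms s in auto)
  then show ?thesis
    using SR[of x] by simp
qed

text \<open>This makes division by \<open>m f\<close> harmless: wherever the denominator is
  \<open>0\<close>, so is the numerator, and the default value \<open>0\<close> of the quotient is
  the right one.\<close>

lemma eigenvalue_orthogonal:
  assumes "e \<in> E" "f \<in> F" "m f = 0"
  shows "s e * (cmod (cinner e f))\<^sup>2 = 0"
proof -
  have "Re (cinner (R f) f) = 0"
    using diagonal_D(4)[OF R assms(2)] assms(3) by (simp add: cinner.zero_left)
  then have "s e * (cmod (cinner e f))\<^sup>2 \<le> 0"
    using eigenvalue_form_le[OF assms(1), of f] by (simp add: cmod_cinner_commute)
  moreover have "0 \<le> s e * (cmod (cinner e f))\<^sup>2"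
    using s[OF assms(1)] by simp
  ultimately show ?thesis by simp
qed

text \<open>Formally the claim is \<open>s e * <R^(-1) e, e> \<le> 1\<close>. The vector
  \<open>y\<close> is \<open>R^(-1) e\<close> truncated to \<open>G\<close>, so that
  \<open><R y, y> = <y, e> = \<kappa>\<close>; then \<open>eigenvalue_form_le\<close> at
  \<open>y\<close> reads \<open>s e * \<kappa>^2 \<le> \<kappa>\<close>.\<close>

lemma eigenvalue_row_sum_finite:
  assumes e: "e \<in> E" and G: "finite G" "G \<subseteq> F"
  shows "(\<Sum>f\<in>G. s e * (cmod (cinner e f))\<^sup>2 / m f) \<le> 1"
proof -
  define \<kappa> where "\<kappa> = (\<Sum>f\<in>G. (cmod (cinner e f))\<^sup>2 / m f)"
  define y where "y = (\<Sum>f\<in>G. scaleC (cinner e f / m f) f)"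
  note F = diagonal_D(3)[OF R]
  have "cinner y e = (\<Sum>f\<in>G. complex_of_real ((cmod (cinner e f))\<^sup>2 / m f))"
    unfolding y_def cinner.sum_left cinner_scaleC_left
    by (simp only: times_divide_eq_left cinner_mult_commute of_real_divide)
  then have ye: "cinner y e = complex_of_real \<kappa>"
    by (simp add: \<kappa>_def)
  have yf: "cinner y f = (if f \<in> G then cinner e f / m f else 0)" if "f \<in> F" for f
  proof -
    have "cinner y f = (\<Sum>g\<in>G. if g = f then cinner e f / m f else 0)"
      unfolding y_def cinner.sum_left cinner_scaleC_left
      using G that by (intro sum.cong) (auto simp: orthonormal_cinner[OF F] subset_iff)
    then show ?thesis
      using G by simp
  qed
  have "((\<lambda>f. m f * (cmod (cinner y f))\<^sup>2) has_sum \<kappa>) F"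
  proof (rule has_sum_finite_neutralI[of G])
    have "m f * (cmod (cinner y f))\<^sup>2 = (cmod (cinner e f))\<^sup>2 / m f" if "f \<in> G" for f
      using that G m[of f] by (auto simp: yf norm_divide power_divide power2_eq_square)
    then show "\<kappa> = (\<Sum>f\<in>G. m f * (cmod (cinner y f))\<^sup>2)"
      by (simp add: \<kappa>_def)
  qed (use G in \<open>auto simp: yf\<close>)
  then have "Re (cinner (R y) y) = \<kappa>"
    using diagonal_form(1)[OF R] has_sum_unique by blast
  then have "s e * \<kappa>\<^sup>2 \<le> \<kappa>"
    using eigenvalue_form_le[OF e, of y] by (simp add: ye)
  moreover have "\<kappa> \<ge> 0"
    unfolding \<kappa>_def using m G by (intro sum_nonneg divide_nonneg_nonneg) auto
  ultimately have "s e * \<kappa> \<le> 1"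
    by (cases "\<kappa> = 0") (auto simp: power2_eq_square mult.assoc[symmetric] mult_le_cancel_right1)
  then show ?thesis
    by (simp add: \<kappa>_def sum_distrib_left)
qed

text \<open>Collects the premises of Jensen's inequality for the row of \<open>e\<close>: under the
  weights \<open>w\<close> the eigenvalues of \<open>R\<close> have mean \<open>s e\<close>, and
  their \<open>q\<close>-th moment is the contribution of \<open>e\<close> to
  \<open>tr (S R^(q-1))\<close>.\<close>

lemma eigenvalue_row:
  assumes e: "e \<in> E" and q: "q > 0"
  defines "w \<equiv> \<lambda>f. s e * (cmod (cinner e f))\<^sup>2 / m f"
  obtains \<sigma> z where "(w has_sum \<sigma>) F" "\<sigma> \<le> 1" "((\<lambda>f. w f * m f) has_sum s e) F"
    "((\<lambda>f. w f * m f powr q) has_sum z) F"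
    "ennreal z = (\<Sum>\<^sub>\<infinity>f\<in>F. ennreal (s e * (cmod (cinner e f))\<^sup>2 * m f powr (q - 1)))"
proof -
  have w0: "0 \<le> w f" if "f \<in> F" for f
    using m[OF that] s[OF e] by (simp add: w_def)
  have summable: "w summable_on F"
    using w0 eigenvalue_row_sum_finite[OF e] unfolding w_def by (rule summable_on_real_bounded)
  then obtain \<sigma> where \<sigma>: "(w has_sum \<sigma>) F"
    by (auto simp: summable_on_def)
  moreover have "\<sigma> \<le> 1"
    using \<sigma> eigenvalue_row_sum_finite[OF e] unfolding w_def by (rule has_sum_le_finite_sums)
  moreover have "((\<lambda>f. w f * m f) has_sum s e) F"
  proof (rule iffD1[OF has_sum_cong])
    show "((\<lambda>f. s e * (cmod (cinner e f))\<^sup>2) has_sum s e) F"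
      using has_sum_cmult_right[OF Parseval[OF diagonal_D(2)[OF R], of e], of "s e"] diagonal_D(5)[OF S e]
      by simp
    show "s e * (cmod (cinner e f))\<^sup>2 = w f * m f" if "f \<in> F" for f
      using eigenvalue_orthogonal[OF e that] by (cases "m f = 0") (auto simp: w_def)
  qed
  moreover
  obtain C where C: "C \<ge> 0" "\<And>f. f \<in> F \<Longrightarrow> \<bar>m f\<bar> \<le> C"
    using diagonal_bounded[OF R] by blast
  have "(\<lambda>f. w f * m f powr q) summable_on F"
  proof (rule summable_on_comparison_test)
    show "(\<lambda>f. w f * C powr q) summable_on F"
      using summable by (rule summable_on_cmult_left)
    show "w f * m f powr q \<le> w f * C powr q" if "f \<in> F" for f
      using C(2)[OF that] m[OF that] q w0[OF that] by (intro mult_left_mono powr_mono2) auto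
  qed (simp add: w0)
  then obtain z where z: "((\<lambda>f. w f * m f powr q) has_sum z) F"
    by (auto simp: summable_on_def)
  moreover have "ennreal z = (\<Sum>\<^sub>\<infinity>f\<in>F. ennreal (s e * (cmod (cinner e f))\<^sup>2 * m f powr (q - 1)))"
  proof -
    \<comment> \<open>At \<open>m f = 0\<close> both sides are \<open>0\<close>, since
      \<open>0 powr r = 0\<close> for every \<open>r\<close>, including the exponents
      \<open>r \<le> 0\<close> that occur for \<open>q \<le> 1\<close>.\<close>
    have "w f * m f powr q = s e * (cmod (cinner e f))\<^sup>2 * m f powr (q - 1)" if "f \<in> F" for f
      using m[OF that] by (cases "m f = 0") (auto simp: w_def powr_diff)
    moreover have "(\<Sum>\<^sub>\<infinity>f\<in>F. ennreal (w f * m f powr q)) = ennreal z"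
      using z by (rule infsum_ennreal_has_sum) (simp add: w0)
    ultimately show ?thesis
      by (simp cong: infsum_cong)
  qed
  ultimately show ?thesis
    by (rule that)
qed

lemma column_sum:
  assumes "f \<in> F"
  shows "(\<Sum>\<^sub>\<infinity>e\<in>E. ennreal (s e * (cmod (cinner e f))\<^sup>2 * m f powr (q - 1))) =
    ennreal (Re (cinner (S f) f) * m f powr (q - 1))"
proof (rule infsum_ennreal_has_sum)
  show "((\<lambda>e. s e * (cmod (cinner e f))\<^sup>2 * m f powr (q - 1)) has_sum
      (Re (cinner (S f) f) * m f powr (q - 1))) E"
    using has_sum_cmult_left[OF diagonal_form(1)[OF S, of f]] by (simp add: cmod_cinner_commute[of f])
qed (simp add: s)

text \<open>This is \<open>tr S^q \<le> tr (S R^(q-1))\<close>. Jensen's inequality is used in each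
  row \<open>e\<close>; exchanging the sums then turns the columns into the diagonal entries
  \<open><S f, f>\<close>.\<close>

lemma power_trace_le_mixed:
  assumes q: "1 \<le> q"
  shows "power_trace q S \<le> (\<Sum>\<^sub>\<infinity>f\<in>F. ennreal (Re (cinner (S f) f) * m f powr (q - 1)))"
proof -
  have "power_trace q S = (\<Sum>\<^sub>\<infinity>e\<in>E. ennreal (s e powr q))"
    using q by (intro power_trace_diagonal[OF S s]) auto
  also have "\<dots> \<le> (\<Sum>\<^sub>\<infinity>e\<in>E. \<Sum>\<^sub>\<infinity>f\<in>F. ennreal (s e * (cmod (cinner e f))\<^sup>2 * m f powr (q - 1)))"
  proof (rule infsum_mono)
    fix e assume e: "e \<in> E"
    obtain \<sigma> z where *: "((\<lambda>f. s e * (cmod (cinner e f))\<^sup>2 / m f) has_sum \<sigma>) F" "\<sigma> \<le> 1"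
      "((\<lambda>f. s e * (cmod (cinner e f))\<^sup>2 / m f * m f) has_sum s e) F"
      "((\<lambda>f. s e * (cmod (cinner e f))\<^sup>2 / m f * m f powr q) has_sum z) F"
      "ennreal z = (\<Sum>\<^sub>\<infinity>f\<in>F. ennreal (s e * (cmod (cinner e f))\<^sup>2 * m f powr (q - 1)))"
      using eigenvalue_row[OF e, of q] q by auto
    have "s e powr q \<le> z"
      by (rule Jensen_powr_ge[OF _ _ *(1-4) q]) (use s[OF e] m in auto)
    then show "ennreal (s e powr q) \<le> (\<Sum>\<^sub>\<infinity>f\<in>F. ennreal (s e * (cmod (cinner e f))\<^sup>2 * m f powr (q - 1)))"
      unfolding *(5)[symmetric] by (rule ennreal_leI)
  qed (auto intro: nonneg_summable_on_complete)
  also have "\<dots> = (\<Sum>\<^sub>\<infinity>f\<in>F. ennreal (Re (cinner (S f) f) * m f powr (q - 1)))"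
    by (subst infsum_swap_ennreal) (simp add: column_sum cong: infsum_cong)
  finally show ?thesis .
qed

lemma power_trace_ge_mixed:
  assumes q: "0 < q" "q \<le> 1"
  shows "(\<Sum>\<^sub>\<infinity>f\<in>F. ennreal (Re (cinner (S f) f) * m f powr (q - 1))) \<le> power_trace q S"
proof -
  have "(\<Sum>\<^sub>\<infinity>f\<in>F. ennreal (Re (cinner (S f) f) * m f powr (q - 1))) =
      (\<Sum>\<^sub>\<infinity>e\<in>E. \<Sum>\<^sub>\<infinity>f\<in>F. ennreal (s e * (cmod (cinner e f))\<^sup>2 * m f powr (q - 1)))"
    by (simp add: infsum_swap_ennreal[of _ F E] column_sum cong: infsum_cong)
  also have "\<dots> \<le> (\<Sum>\<^sub>\<infinity>e\<in>E. ennreal (s e powr q))"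
  proof (rule infsum_mono)
    fix e assume e: "e \<in> E"
    obtain \<sigma> z where *: "((\<lambda>f. s e * (cmod (cinner e f))\<^sup>2 / m f) has_sum \<sigma>) F" "\<sigma> \<le> 1"
      "((\<lambda>f. s e * (cmod (cinner e f))\<^sup>2 / m f * m f) has_sum s e) F"
      "((\<lambda>f. s e * (cmod (cinner e f))\<^sup>2 / m f * m f powr q) has_sum z) F"
      "ennreal z = (\<Sum>\<^sub>\<infinity>f\<in>F. ennreal (s e * (cmod (cinner e f))\<^sup>2 * m f powr (q - 1)))"
      using eigenvalue_row[OF e, of q] q by auto
    have "z \<le> s e powr q"
      by (rule Jensen_powr_le[OF _ _ *(1-4) q]) (use s[OF e] m in auto)
    then show "(\<Sum>\<^sub>\<infinity>f\<in>F. ennreal (s e * (cmod (cinner e f))\<^sup>2 * m f powr (q - 1))) \<le> ennreal (s e powr q)"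
      unfolding *(5)[symmetric] by (rule ennreal_leI)
  qed (auto intro: nonneg_summable_on_complete)
  also have "\<dots> = power_trace q S"
    using q by (intro power_trace_diagonal[OF S s, symmetric]) auto
  finally show ?thesis .
qed

end

text \<open>The way back from extended to real sums: a finite total bounds all finite partial
  sums.\<close>

lemma ennreal_infsum_finiteD:
  assumes f: "\<And>x. x \<in> A \<Longrightarrow> 0 \<le> f x" and fin: "(\<Sum>\<^sub>\<infinity>x\<in>A. ennreal (f x)) < \<infinity>"
  shows "(f has_sum enn2real (\<Sum>\<^sub>\<infinity>x\<in>A. ennreal (f x))) A"
proof -
  have "f summable_on A"
  proof (rule summable_on_real_bounded)
    fix G assume G: "finite G" "G \<subseteq> A"
    have "ennreal (sum f G) = (\<Sum>x\<in>G. ennreal (f x))"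
      using f G by (intro sum_ennreal[symmetric]) auto
    also have "\<dots> \<le> (\<Sum>\<^sub>\<infinity>x\<in>A. ennreal (f x))"
      using G by (intro finite_sum_le_infsum_ennreal) auto
    finally have "enn2real (ennreal (sum f G)) \<le> enn2real (\<Sum>\<^sub>\<infinity>x\<in>A. ennreal (f x))"
      using fin by (intro enn2real_mono) auto
    then show "sum f G \<le> enn2real (\<Sum>\<^sub>\<infinity>x\<in>A. ennreal (f x))"
      using f G by (simp add: sum_nonneg subset_iff)
  qed (rule f)
  then obtain t where t: "(f has_sum t) A"
    by (auto simp: summable_on_def)
  then have "(\<Sum>\<^sub>\<infinity>x\<in>A. ennreal (f x)) = ennreal t"
    using f by (rule infsum_ennreal_has_sum)
  moreover have "t \<ge> 0"
    using t f by (rule has_sum_nonneg)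
  ultimately show ?thesis
    using t by simp
qed

subsection \<open>Triangle inequalities for sums of compact positive operators\<close>

definition compact_positive :: "('a::chilbert_space \<Rightarrow> 'a) \<Rightarrow> bool" where
  "compact_positive T \<longleftrightarrow> positive_operator T \<and> compact_operator T"

lemma compact_positive_eigenbasis:
  assumes "compact_positive T"
  obtains E l where "diagonal T E l" "\<And>e. e \<in> E \<Longrightarrow> 0 \<le> l e"
  using assms compact_positive_diagonal unfolding compact_positive_def by blast

section \<open>Closure properties of compact and of compact positive operators\<close>

lemma bounded_clinear_add:
  assumes "bounded_clinear S" "bounded_clinear T"
  shows "bounded_clinear (\<lambda>x. S x + T x)"
  using assms by (auto simp: bounded_clinear_def scaleC_add_right intro: bounded_linear_add)

lemma bounded_clinear_scaleR:
  assumes "bounded_clinear T"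
  shows "bounded_clinear (\<lambda>x. r *\<^sub>R T x)"
  using assms
  by (auto simp: bounded_clinear_def scaleC.scaleR_right intro: bounded_linear_const_scaleR)

lemma compact_operatorI:
  assumes "bounded_clinear T" "compact K" "T ` cball 0 1 \<subseteq> K"
  shows "compact_operator T"
proof -
  have "closure (T ` cball 0 1) \<subseteq> K"
    using assms by (intro closure_minimal compact_imp_closed)
  then have "compact (K \<inter> closure (T ` cball 0 1))"
    using assms by (intro compact_Int_closed) auto
  with assms(1) \<open>closure (T ` cball 0 1) \<subseteq> K\<close> show ?thesis
    by (simp add: compact_operator_def Int_absorb1)
qed

lemma compact_operator_add:
  assumes "compact_operator S" "compact_operator T"
  shows "compact_operator (\<lambda>x. S x + T x)"
proof (rule compact_operatorI)
  show "bounded_clinear (\<lambda>x. S x + T x)"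
    using assms by (intro bounded_clinear_add) (auto simp: compact_operator_def)
  show "compact {x + y | x y. x \<in> closure (S ` cball 0 1) \<and> y \<in> closure (T ` cball 0 1)}"
    using assms by (intro compact_sums) (auto simp: compact_operator_def)
  show "(\<lambda>x. S x + T x) ` cball 0 1 \<subseteq>
      {x + y | x y. x \<in> closure (S ` cball 0 1) \<and> y \<in> closure (T ` cball 0 1)}"
  proof (rule image_subsetI)
    fix x :: 'a assume "x \<in> cball 0 1"
    then have "S x \<in> closure (S ` cball 0 1)" "T x \<in> closure (T ` cball 0 1)"
      by (auto intro!: subsetD[OF closure_subset])
    then show "S x + T x \<in> {x + y | x y. x \<in> closure (S ` cball 0 1) \<and> y \<in> closure (T ` cball 0 1)}"
      by blast
  qed
qed

lemma compact_operator_compose: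
  assumes "bounded_clinear S" "compact_operator T"
  shows "compact_operator (S \<circ> T)"
proof (rule compact_operatorI)
  show "bounded_clinear (S \<circ> T)"
    using assms by (intro bounded_clinear_compose) (auto simp: compact_operator_def)
  show "compact (S ` closure (T ` cball 0 1))"
    using assms by (intro compact_continuous_image linear_continuous_on)
      (auto simp: compact_operator_def bounded_clinear_def)
  show "(S \<circ> T) ` cball 0 1 \<subseteq> S ` closure (T ` cball 0 1)"
    unfolding image_comp[symmetric] by (intro image_mono closure_subset)
qed

lemma compact_operator_scaleR:
  assumes "compact_operator T"
  shows "compact_operator (\<lambda>x. r *\<^sub>R T x)"
proof -
  have "bounded_clinear (\<lambda>x. r *\<^sub>R x)"
    unfolding bounded_clinear_def
    by (simp add: scaleC.scaleR_right bounded_linear_scaleR_right)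
  from compact_operator_compose[OF this assms] show ?thesis
    by (simp add: o_def)
qed

lemma compact_positive_add:
  assumes "compact_positive S" "compact_positive T"
  shows "compact_positive (\<lambda>x. S x + T x)"
  using assms
  by (auto simp: compact_positive_def positive_operator_def compact_operator_add bounded_clinear_add
      cinner.add_left)

lemma compact_positive_zero: "compact_positive (\<lambda>x. 0)"
proof -
  have "bounded_clinear (\<lambda>x::'a. 0)"
    by (simp add: bounded_clinear_def scaleC.zero_right bounded_linear_zero)
  moreover from this have "compact_operator (\<lambda>x::'a. 0)"
    by (rule compact_operatorI[of _ "{0}"]) auto
  ultimately show ?thesis
    by (simp add: compact_positive_def positive_operator_def cinner.zero_left)
qed

lemma compact_positive_sum:
  assumes "\<And>i. i \<in> I \<Longrightarrow> compact_positive (S i)"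
  shows "compact_positive (\<lambda>x. \<Sum>i\<in>I. S i x)"
  using assms
  by (induction I rule: infinite_finite_induct)
    (simp_all add: compact_positive_zero compact_positive_add)

lemma compact_positive_form_nonneg: "compact_positive T \<Longrightarrow> 0 \<le> Re (cinner (T x) x)"
  by (simp add: compact_positive_def positive_operator_def)

lemma compact_positive_adjoint_compose:
  assumes T: "compact_operator T"
  shows "compact_positive (cadjoint T \<circ> T)"
proof -
  have bc: "bounded_clinear T"
    using T by (simp add: compact_operator_def)
  note adj = bounded_clinear_cadjoint[OF bc]
  have "cinner (cadjoint T (T x)) x = complex_of_real ((norm (T x))\<^sup>2)" for x
    by (simp only: cinner_cadjoint_left[OF bc] cinner_self)
  then show ?thesis
    using compact_operator_compose[OF adj T] bounded_clinear_compose[OF adj bc]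
    by (simp add: compact_positive_def positive_operator_def)
qed

text \<open>Weighting the \<open>i\<close>-th summand by \<open>\<alpha>\<^sub>i / \<Sum>\<alpha>\<close> turns the triangle inequality for
  \<open>(\<Sum>x\<^sup>q)\<^bsup>1/q\<^esup>\<close> into a pointwise application of Jensen's inequality.\<close>

definition Minkowski_weight :: "real \<Rightarrow> ('i \<Rightarrow> real) \<Rightarrow> 'i set \<Rightarrow> 'i \<Rightarrow> real" where
  "Minkowski_weight q \<alpha> I i = \<alpha> i / sum \<alpha> I * (sum \<alpha> I / \<alpha> i) powr q"

context
  fixes I :: "'i set" and a \<alpha> :: "'i \<Rightarrow> real" and q :: real
  assumes I: "finite I" and \<alpha>: "\<And>i. i \<in> I \<Longrightarrow> 0 \<le> \<alpha> i" and q: "0 < q"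
begin

lemma Minkowski_weight_nonneg: "i \<in> I \<Longrightarrow> 0 \<le> Minkowski_weight q \<alpha> I i"
  using \<alpha> I by (auto simp: Minkowski_weight_def intro!: mult_nonneg_nonneg divide_nonneg_nonneg sum_nonneg)

text \<open>The weights are tuned so that Jensen's inequality becomes an equality at
  \<open>a = \<alpha>\<close>. This is what finally turns a weighted sum of \<open>q\<close>-th
  powers of norms into the \<open>q\<close>-th power of the sum of the norms.\<close>

lemma Minkowski_weight_sum:
  "(\<Sum>i\<in>I. Minkowski_weight q \<alpha> I i * \<alpha> i powr q) = sum \<alpha> I powr q"
proof (cases "sum \<alpha> I = 0")
  case True
  then show ?thesis
    by (simp add: Minkowski_weight_def)
next
  case False
  have pos: "sum \<alpha> I > 0"
    using False \<alpha> I by (simp add: sum_nonneg order_less_le)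
  have "Minkowski_weight q \<alpha> I i * \<alpha> i powr q = \<alpha> i / sum \<alpha> I * sum \<alpha> I powr q" if "i \<in> I" for i
    using pos \<alpha>[OF that] by (cases "\<alpha> i = 0") (auto simp: Minkowski_weight_def powr_divide)
  then have "(\<Sum>i\<in>I. Minkowski_weight q \<alpha> I i * \<alpha> i powr q) = (\<Sum>i\<in>I. \<alpha> i / sum \<alpha> I * sum \<alpha> I powr q)"
    by simp
  also have "\<dots> = sum \<alpha> I powr q"
    using False by (simp flip: sum_distrib_right sum_divide_distrib)
  finally show ?thesis .
qed

context
  assumes a: "\<And>i. i \<in> I \<Longrightarrow> 0 \<le> a i" and pos: "0 < sum \<alpha> I"
begin

text \<open>Jensen's inequality is to be applied with weights
  \<open>\<alpha> i / sum \<alpha> I\<close> at the points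
  \<open>a i * (sum \<alpha> I / \<alpha> i)\<close>, whose mean is formally \<open>sum a I\<close>.
  Indices with \<open>\<alpha> i = 0\<close> drop out of the mean because division by zero gives
  \<open>0\<close>.\<close>

lemma Minkowski_weight_Jensen:
  shows "(\<alpha> has_sum sum \<alpha> I) I"
    and "((\<lambda>i. \<alpha> i / sum \<alpha> I) has_sum 1) I"
    and "((\<lambda>i. \<alpha> i / sum \<alpha> I * (a i * (sum \<alpha> I / \<alpha> i))) has_sum (\<Sum>i\<in>{i\<in>I. \<alpha> i \<noteq> 0}. a i)) I"
    and "((\<lambda>i. \<alpha> i / sum \<alpha> I * (a i * (sum \<alpha> I / \<alpha> i)) powr q) has_sum
      (\<Sum>i\<in>I. Minkowski_weight q \<alpha> I i * a i powr q)) I"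
proof -
  show "(\<alpha> has_sum sum \<alpha> I) I"
    using I by (intro has_sum_finiteI) auto
  show "((\<lambda>i. \<alpha> i / sum \<alpha> I) has_sum 1) I"
    using pos I by (intro has_sum_finiteI) (auto simp flip: sum_divide_distrib)
  show "((\<lambda>i. \<alpha> i / sum \<alpha> I * (a i * (sum \<alpha> I / \<alpha> i))) has_sum (\<Sum>i\<in>{i\<in>I. \<alpha> i \<noteq> 0}. a i)) I"
    using pos I by (intro has_sum_finite_neutralI[of "{i\<in>I. \<alpha> i \<noteq> 0}"] sum.cong) auto
  show "((\<lambda>i. \<alpha> i / sum \<alpha> I * (a i * (sum \<alpha> I / \<alpha> i)) powr q) has_sum
      (\<Sum>i\<in>I. Minkowski_weight q \<alpha> I i * a i powr q)) I"
  proof (rule has_sum_finiteI[OF I], rule sum.cong)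
    show "Minkowski_weight q \<alpha> I i * a i powr q = \<alpha> i / sum \<alpha> I * (a i * (sum \<alpha> I / \<alpha> i)) powr q"
      if "i \<in> I" for i
      using powr_mult[of "a i" "sum \<alpha> I / \<alpha> i" q] a[OF that] \<alpha>[OF that] pos
      by (simp add: Minkowski_weight_def mult_ac)
  qed simp
qed

lemma Minkowski_pointwise_le:
  assumes "q \<le> 1"
  shows "(\<Sum>i\<in>I. Minkowski_weight q \<alpha> I i * a i powr q) \<le> (\<Sum>i\<in>I. a i) powr q"
proof -
  have "(\<Sum>i\<in>I. Minkowski_weight q \<alpha> I i * a i powr q) \<le> (\<Sum>i\<in>{i\<in>I. \<alpha> i \<noteq> 0}. a i) powr q"
    by (rule Jensen_powr_le[OF _ _ Minkowski_weight_Jensen(2) _ Minkowski_weight_Jensen(3,4)])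
      (use a \<alpha> pos q assms in auto)
  \<comment> \<open>Restoring the indices with \<open>\<alpha> i = 0\<close> only increases the
    sum.\<close>
  also have "\<dots> \<le> (\<Sum>i\<in>I. a i) powr q"
    using q a I by (intro powr_mono2 sum_mono2 sum_nonneg) auto
  finally show ?thesis .
qed

text \<open>In this direction the dropped indices must contribute nothing to the sum, which is the
  purpose of \<open>zero\<close>.\<close>

lemma Minkowski_pointwise_ge:
  assumes "1 \<le> q" and zero: "\<And>i. i \<in> I \<Longrightarrow> \<alpha> i = 0 \<Longrightarrow> a i = 0"
  shows "(\<Sum>i\<in>I. a i) powr q \<le> (\<Sum>i\<in>I. Minkowski_weight q \<alpha> I i * a i powr q)"
proof -
  have "(\<Sum>i\<in>{i\<in>I. \<alpha> i \<noteq> 0}. a i) = (\<Sum>i\<in>I. a i)"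
    using I zero by (intro sum.mono_neutral_left) auto
  moreover have "(\<Sum>i\<in>{i\<in>I. \<alpha> i \<noteq> 0}. a i) powr q \<le> (\<Sum>i\<in>I. Minkowski_weight q \<alpha> I i * a i powr q)"
    by (rule Jensen_powr_ge[OF _ _ Minkowski_weight_Jensen(2) _ Minkowski_weight_Jensen(3,4)])
      (use a \<alpha> pos q assms in auto)
  ultimately show ?thesis by simp
qed

end

end

lemma powr_le_imp_le:
  fixes x y q :: real
  assumes "0 < q" "0 \<le> y" "x powr q \<le> y powr q"
  shows "x \<le> y"
  using assms by (meson not_le powr_less_mono2)

lemma has_sum_finite_sum:
  fixes f :: "'i \<Rightarrow> 'j \<Rightarrow> real"
  assumes "\<And>i. i \<in> I \<Longrightarrow> (f i has_sum t i) A"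
  shows "((\<lambda>x. \<Sum>i\<in>I. f i x) has_sum (\<Sum>i\<in>I. t i)) A"
  using assms by (induction I rule: infinite_finite_induct) (simp_all add: has_sum_add)

lemma power_norm_has_sum:
  assumes T: "diagonal T E l" and l: "\<And>e. e \<in> E \<Longrightarrow> 0 \<le> l e" and q: "q > 0"
    and fin: "power_trace q T < \<infinity>"
  shows "((\<lambda>e. l e powr q) has_sum power_norm q T powr q) E"
  using ennreal_infsum_finiteD[of E "\<lambda>e. l e powr q"] fin power_trace_diagonal[OF T l q]
  by (simp add: power_norm_powr[OF q])

lemma power_norm_eqI:
  assumes T: "diagonal T E l" and l: "\<And>e. e \<in> E \<Longrightarrow> 0 \<le> l e" and q: "q > 0"
    and sum: "((\<lambda>e. l e powr q) has_sum t) E"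
  shows "power_trace q T < \<infinity>" "power_norm q T powr q = t"
proof -
  have "power_trace q T = ennreal t"
    using infsum_ennreal_has_sum[OF sum] by (simp add: power_trace_diagonal[OF T l q])
  moreover have "t \<ge> 0"
    using sum by (rule has_sum_nonneg) simp
  ultimately show "power_trace q T < \<infinity>" "power_norm q T powr q = t"
    by (simp_all add: power_norm_powr[OF q])
qed

context
  fixes S :: "'i \<Rightarrow> 'a::chilbert_space \<Rightarrow> 'a" and I :: "'i set" and R :: "'a \<Rightarrow> 'a"
  assumes I: "finite I" and S: "\<And>i. i \<in> I \<Longrightarrow> compact_positive (S i)"
    and R_sum: "\<And>x. R x = (\<Sum>i\<in>I. S i x)"
begin

lemma compact_positive_total: "compact_positive R"
  using compact_positive_sum[of I S] S by (simp add: R_sum[abs_def])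

lemma form_total: "Re (cinner (R x) x) = (\<Sum>i\<in>I. Re (cinner (S i x) x))"
  by (simp add: R_sum cinner.sum_left)

lemma form_le:
  assumes "i \<in> I"
  shows "Re (cinner (S i x) x) \<le> Re (cinner (R x) x)"
  unfolding form_total
  using assms I S by (intro member_le_sum) (auto intro: compact_positive_form_nonneg)

lemma form_eigenvalue:
  assumes "diagonal R F m" "f \<in> F"
  shows "(\<Sum>i\<in>I. Re (cinner (S i f) f)) = m f"
  unfolding form_total[symmetric]
  using diagonal_D(4,5)[OF assms] by (simp add: cinner.scaleR_left cinner_self)

context
  fixes q :: real
  assumes q: "q > 0"
begin

text \<open>The diagonal entries of the summands at \<open>f\<close> add up to \<open>m f\<close>,
  and \<open>m f * m f powr (q - 1) = m f powr q\<close>. Hence the mixed traces add up without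
  loss, and the comparison of each summand with its mixed trace yields super- or
  subadditivity.\<close>

lemma mixed_sum:
  assumes R: "diagonal R F m" and m: "\<And>f. f \<in> F \<Longrightarrow> 0 \<le> m f"
  shows "(\<Sum>i\<in>I. \<Sum>\<^sub>\<infinity>f\<in>F. ennreal (Re (cinner (S i f) f) * m f powr (q - 1))) = power_trace q R"
proof -
  have "(\<Sum>i\<in>I. ennreal (Re (cinner (S i f) f) * m f powr (q - 1))) = ennreal (m f powr q)"
    if "f \<in> F" for f
  proof -
    have "(\<Sum>i\<in>I. ennreal (Re (cinner (S i f) f) * m f powr (q - 1))) =
        ennreal ((\<Sum>i\<in>I. Re (cinner (S i f) f)) * m f powr (q - 1))"
      unfolding sum_distrib_right by (intro sum_ennreal) (simp add: S compact_positive_form_nonneg)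
    also have "(\<Sum>i\<in>I. Re (cinner (S i f) f)) * m f powr (q - 1) = m f powr q"
      using m[OF that] by (cases "m f = 0") (auto simp: form_eigenvalue[OF R that] powr_diff)
    finally show ?thesis .
  qed
  then show ?thesis
    by (simp add: sum_infsum_ennreal power_trace_diagonal[OF R m q] cong: infsum_cong)
qed

lemma power_trace_superadditive:
  assumes "1 \<le> q"
  shows "(\<Sum>i\<in>I. power_trace q (S i)) \<le> power_trace q R"
proof -
  obtain F m where R: "diagonal R F m" and m: "\<And>f. f \<in> F \<Longrightarrow> 0 \<le> m f"
    using compact_positive_eigenbasis[OF compact_positive_total] by blast
  have "(\<Sum>i\<in>I. power_trace q (S i)) \<le>
      (\<Sum>i\<in>I. \<Sum>\<^sub>\<infinity>f\<in>F. ennreal (Re (cinner (S i f) f) * m f powr (q - 1)))"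
  proof (rule sum_mono)
    fix i assume i: "i \<in> I"
    obtain E s where E: "diagonal (S i) E s" "\<And>e. e \<in> E \<Longrightarrow> 0 \<le> s e"
      using compact_positive_eigenbasis[OF S[OF i]] by blast
    show "power_trace q (S i) \<le> (\<Sum>\<^sub>\<infinity>f\<in>F. ennreal (Re (cinner (S i f) f) * m f powr (q - 1)))"
      by (rule power_trace_le_mixed[OF E R m form_le[OF i] assms])
  qed
  then show ?thesis
    by (simp add: mixed_sum[OF R m])
qed

lemma power_trace_subadditive:
  assumes "q \<le> 1"
  shows "power_trace q R \<le> (\<Sum>i\<in>I. power_trace q (S i))"
proof -
  obtain F m where R: "diagonal R F m" and m: "\<And>f. f \<in> F \<Longrightarrow> 0 \<le> m f"
    using compact_positive_eigenbasis[OF compact_positive_total] by blast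
  have "(\<Sum>i\<in>I. \<Sum>\<^sub>\<infinity>f\<in>F. ennreal (Re (cinner (S i f) f) * m f powr (q - 1))) \<le>
      (\<Sum>i\<in>I. power_trace q (S i))"
  proof (rule sum_mono)
    fix i assume i: "i \<in> I"
    obtain E s where E: "diagonal (S i) E s" "\<And>e. e \<in> E \<Longrightarrow> 0 \<le> s e"
      using compact_positive_eigenbasis[OF S[OF i]] by blast
    show "(\<Sum>\<^sub>\<infinity>f\<in>F. ennreal (Re (cinner (S i f) f) * m f powr (q - 1))) \<le> power_trace q (S i)"
      by (rule power_trace_ge_mixed[OF E R m form_le[OF i] q assms])
  qed
  then show ?thesis
    by (simp add: mixed_sum[OF R m])
qed

text \<open>In an eigenbasis \<open>F\<close> of \<open>R\<close>, the pointwise inequality bounds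
  \<open>m f powr q\<close> by the weighted sum of the \<open>a i f powr q\<close>. Summing over
  \<open>f\<close>, the Peierls inequality bounds each diagonal sum by
  \<open>\<alpha> i powr q\<close>, and \<open>Minkowski_weight_sum\<close> evaluates the
  result.\<close>

lemma power_norm_triangle:
  assumes q1: "1 \<le> q" and fin: "\<And>i. i \<in> I \<Longrightarrow> power_trace q (S i) < \<infinity>"
  shows "power_trace q R < \<infinity>" "power_norm q R \<le> (\<Sum>i\<in>I. power_norm q (S i))"
proof -
  obtain F m where R: "diagonal R F m" and m: "\<And>f. f \<in> F \<Longrightarrow> 0 \<le> m f"
    using compact_positive_eigenbasis[OF compact_positive_total] by blast
  note F = diagonal_D(2)[OF R]
  define a where "a i f = Re (cinner (S i f) f)" for i f
  define \<alpha> where "\<alpha> i = power_norm q (S i)" for i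
  have a0: "0 \<le> a i f" if "i \<in> I" for i f
    using compact_positive_form_nonneg[OF S[OF that]] by (simp add: a_def)
  have \<alpha>0: "0 \<le> \<alpha> i" for i
    by (simp add: \<alpha>_def power_norm_nonneg)
  have "\<exists>t. ((\<lambda>f. a i f powr q) has_sum t) F \<and> t \<le> \<alpha> i powr q" if i: "i \<in> I" for i
  proof -
    obtain E s where E: "diagonal (S i) E s" "\<And>e. e \<in> E \<Longrightarrow> 0 \<le> s e"
      using compact_positive_eigenbasis[OF S[OF i]] by blast
    have le: "(\<Sum>\<^sub>\<infinity>f\<in>F. ennreal (a i f powr q)) \<le> power_trace q (S i)"
      unfolding a_def by (rule Peierls_trace_ge[OF E q q1 F])
    then have lt: "(\<Sum>\<^sub>\<infinity>f\<in>F. ennreal (a i f powr q)) < \<infinity>"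
      using fin[OF i] by (rule order_le_less_trans)
    have "enn2real (\<Sum>\<^sub>\<infinity>f\<in>F. ennreal (a i f powr q)) \<le> \<alpha> i powr q"
      unfolding \<alpha>_def power_norm_powr[OF q] using le fin[OF i] by (intro enn2real_mono) auto
    with ennreal_infsum_finiteD[OF _ lt] show ?thesis
      by auto
  qed
  then obtain t where t: "\<And>i. i \<in> I \<Longrightarrow> ((\<lambda>f. a i f powr q) has_sum t i) F"
    and t_le: "\<And>i. i \<in> I \<Longrightarrow> t i \<le> \<alpha> i powr q"
    by metis
  \<comment> \<open>A summand of norm \<open>0\<close> has zero diagonal entries;
    \<open>Minkowski_pointwise_ge\<close> relies on this where its weights degenerate.\<close>
  have zero: "a i f = 0" if "i \<in> I" "f \<in> F" "\<alpha> i = 0" for i f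
    using nonneg_has_sum_le_0D[OF t[OF that(1)] _ _ that(2)] t_le[OF that(1)] that(3) by simp
  define M where "M = Minkowski_weight q \<alpha> I"
  have M0: "0 \<le> M i" if "i \<in> I" for i
    unfolding M_def using Minkowski_weight_nonneg[OF I _ q that] \<alpha>0 by simp
  have le: "m f powr q \<le> (\<Sum>i\<in>I. M i * a i f powr q)" if "f \<in> F" for f
  proof -
    have mf: "m f = (\<Sum>i\<in>I. a i f)"
      using form_eigenvalue[OF R that] by (simp add: a_def)
    show ?thesis
    proof (cases "sum \<alpha> I = 0")
      case True
      then have "\<alpha> i = 0" if "i \<in> I" for i
        using that I \<alpha>0 by (simp add: sum_nonneg_eq_0_iff)
      then have "m f = 0"
        unfolding mf using zero[OF _ that] by (intro sum.neutral) auto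
      then show ?thesis
        using M0 by (simp add: sum_nonneg)
    next
      case False
      then have "sum \<alpha> I > 0"
        using \<alpha>0 by (simp add: sum_nonneg order_less_le)
      then show ?thesis
        unfolding mf M_def using zero[OF _ that] a0 \<alpha>0 
        by (intro Minkowski_pointwise_ge[OF I _ q]) (auto simp: q1)
    qed
  qed
  have sum: "((\<lambda>f. \<Sum>i\<in>I. M i * a i f powr q) has_sum (\<Sum>i\<in>I. M i * t i)) F"
    using t by (intro has_sum_finite_sum has_sum_cmult_right)
  then have "(\<lambda>f. m f powr q) summable_on F"
    using le by (intro summable_on_comparison_test[OF has_sum_imp_summable]) auto
  then obtain u where u: "((\<lambda>f. m f powr q) has_sum u) F"
    by (auto simp: summable_on_def)
  show "power_trace q R < \<infinity>"
    by (rule power_norm_eqI[OF R m q u])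
  have "power_norm q R powr q = u"
    by (rule power_norm_eqI[OF R m q u])
  also have "u \<le> (\<Sum>i\<in>I. M i * t i)"
    using u sum le by (rule has_sum_mono)
  also have "\<dots> \<le> (\<Sum>i\<in>I. M i * \<alpha> i powr q)"
    using M0 t_le by (intro sum_mono mult_left_mono) auto
  also have "\<dots> = sum \<alpha> I powr q"
    unfolding M_def by (rule Minkowski_weight_sum[OF I _ q]) (rule \<alpha>0)
  finally show "power_norm q R \<le> (\<Sum>i\<in>I. power_norm q (S i))"
    unfolding \<alpha>_def by (rule powr_le_imp_le[OF q, rotated]) (simp add: sum_nonneg power_norm_nonneg)
qed

text \<open>The same scheme with the Peierls and Minkowski inequalities reversed. Finiteness is
  assumed of the sum and passes to the diagonals of the summands through
  \<open>a i f \<le> m f\<close>.\<close>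

lemma power_norm_reverse_triangle:
  assumes q1: "q \<le> 1" and fin: "power_trace q R < \<infinity>"
  shows "(\<Sum>i\<in>I. power_norm q (S i)) \<le> power_norm q R"
proof -
  obtain F m where R: "diagonal R F m" and m: "\<And>f. f \<in> F \<Longrightarrow> 0 \<le> m f"
    using compact_positive_eigenbasis[OF compact_positive_total] by blast
  note F = diagonal_D(2)[OF R]
  define a where "a i f = Re (cinner (S i f) f)" for i f
  define \<alpha> where "\<alpha> i = power_norm q (S i)" for i
  have a0: "0 \<le> a i f" if "i \<in> I" for i f
    using compact_positive_form_nonneg[OF S[OF that]] by (simp add: a_def)
  have \<alpha>0: "0 \<le> \<alpha> i" for i
    by (simp add: \<alpha>_def power_norm_nonneg)
  have mf: "m f = (\<Sum>i\<in>I. a i f)" if "f \<in> F" for f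
    using form_eigenvalue[OF R that] by (simp add: a_def)
  have a_le: "a i f \<le> m f" if "i \<in> I" "f \<in> F" for i f
    unfolding mf[OF that(2)] using that a0 I by (intro member_le_sum) auto
  have u: "((\<lambda>f. m f powr q) has_sum power_norm q R powr q) F"
    by (rule power_norm_has_sum[OF R m q fin])
  have "\<exists>t. ((\<lambda>f. a i f powr q) has_sum t) F \<and> \<alpha> i powr q \<le> t" if i: "i \<in> I" for i
  proof -
    obtain E s where E: "diagonal (S i) E s" "\<And>e. e \<in> E \<Longrightarrow> 0 \<le> s e"
      using compact_positive_eigenbasis[OF S[OF i]] by blast
    have "(\<lambda>f. a i f powr q) summable_on F"
      using a_le[OF i] a0[OF i] q
      by (intro summable_on_comparison_test[OF has_sum_imp_summable[OF u]] powr_mono2) auto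
    then obtain t where t: "((\<lambda>f. a i f powr q) has_sum t) F"
      by (auto simp: summable_on_def)
    have t0: "t \<ge> 0"
      using t by (rule has_sum_nonneg) simp
    have "power_trace q (S i) \<le> ennreal t"
      using Peierls_trace_le[OF E q q1 F] infsum_ennreal_has_sum[OF t] by (simp add: a_def)
    then have "enn2real (power_trace q (S i)) \<le> t"
      using t0 by (simp add: enn2real_leI)
    then show ?thesis
      using t by (auto simp: \<alpha>_def power_norm_powr[OF q])
  qed
  then obtain t where t: "\<And>i. i \<in> I \<Longrightarrow> ((\<lambda>f. a i f powr q) has_sum t i) F"
    and t_ge: "\<And>i. i \<in> I \<Longrightarrow> \<alpha> i powr q \<le> t i"
    by metis
  define M where "M = Minkowski_weight q \<alpha> I"
  have M0: "0 \<le> M i" if "i \<in> I" for i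
    unfolding M_def using Minkowski_weight_nonneg[OF I _ q that] \<alpha>0 by simp
  have sum: "((\<lambda>f. \<Sum>i\<in>I. M i * a i f powr q) has_sum (\<Sum>i\<in>I. M i * t i)) F"
    using t by (intro has_sum_finite_sum has_sum_cmult_right)
  show ?thesis
  proof (cases "sum \<alpha> I = 0")
    case True
    then show ?thesis
      by (simp add: \<alpha>_def power_norm_nonneg)
  next
    case False
    then have pos: "sum \<alpha> I > 0"
      using \<alpha>0 by (simp add: sum_nonneg order_less_le)
    have le: "(\<Sum>i\<in>I. M i * a i f powr q) \<le> m f powr q" if "f \<in> F" for f
      unfolding mf[OF that] M_def using a0 \<alpha>0 pos
      by (intro Minkowski_pointwise_le[OF I _ q]) (auto simp: q1)
    have "sum \<alpha> I powr q = (\<Sum>i\<in>I. M i * \<alpha> i powr q)"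
      unfolding M_def by (rule Minkowski_weight_sum[OF I _ q, symmetric]) (rule \<alpha>0)
    also have "\<dots> \<le> (\<Sum>i\<in>I. M i * t i)"
      using M0 t_ge by (intro sum_mono mult_left_mono) auto
    also have "\<dots> \<le> power_norm q R powr q"
      using sum u le by (rule has_sum_mono)
    finally show ?thesis
      unfolding \<alpha>_def by (rule powr_le_imp_le[OF q, rotated]) (rule power_norm_nonneg)
  qed
qed

end

end

subsection \<open>Schatten norms\<close>

lemma powr_mean_has_sum:
  fixes a :: "'i \<Rightarrow> real"
  assumes "finite I" "I \<noteq> {}"
  shows "((\<lambda>i. 1 / card I) has_sum 1) I"
    "((\<lambda>i. 1 / card I * a i) has_sum (sum a I / card I)) I"
    "((\<lambda>i. 1 / card I * a i powr q) has_sum ((\<Sum>i\<in>I. a i powr q) / card I)) I"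
  using assms by (auto intro!: has_sum_finiteI simp: sum_divide_distrib split: if_splits)

lemma card_powr_sum:
  fixes a :: "'i \<Rightarrow> real"
  assumes "finite I" "I \<noteq> {}" and q: "q > 0" and a: "\<And>i. i \<in> I \<Longrightarrow> 0 \<le> a i"
  shows "(card I powr (1 / q - 1) * sum a I) powr q = card I * (sum a I / card I) powr q"
proof -
  have "card I > 0"
    using assms by (simp add: card_gt_0_iff)
  moreover have "sum a I \<ge> 0"
    using a by (rule sum_nonneg)
  ultimately show ?thesis
    using q by (simp add: powr_mult powr_powr powr_divide left_diff_distrib powr_diff)
qed

text \<open>Jensen's inequality for the uniform distribution on \<open>I\<close>, cleared of
  denominators.\<close>

lemma power_sum_ge_mean:
  fixes a :: "'i \<Rightarrow> real"
  assumes I: "finite I" "I \<noteq> {}" and q: "1 \<le> q" and a: "\<And>i. i \<in> I \<Longrightarrow> 0 \<le> a i"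
  shows "(card I powr (1 / q - 1) * sum a I) powr q \<le> (\<Sum>i\<in>I. a i powr q)"
proof -
  have "(sum a I / card I) powr q \<le> (\<Sum>i\<in>I. a i powr q) / card I"
    by (rule Jensen_powr_ge[OF _ _ powr_mean_has_sum(1)[OF I] _ powr_mean_has_sum(2,3)[OF I]])
      (use a q in auto)
  then have "card I * (sum a I / card I) powr q \<le> (\<Sum>i\<in>I. a i powr q)"
    using I by (simp add: field_simps card_gt_0_iff)
  then show ?thesis
    using card_powr_sum[OF I _ a] q by simp
qed

lemma power_sum_le_mean:
  fixes a :: "'i \<Rightarrow> real"
  assumes I: "finite I" "I \<noteq> {}" and q: "0 < q" "q \<le> 1" and a: "\<And>i. i \<in> I \<Longrightarrow> 0 \<le> a i"
  shows "(\<Sum>i\<in>I. a i powr q) \<le> (card I powr (1 / q - 1) * sum a I) powr q"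
proof -
  have "(\<Sum>i\<in>I. a i powr q) / card I \<le> (sum a I / card I) powr q"
    by (rule Jensen_powr_le[OF _ _ powr_mean_has_sum(1)[OF I] _ powr_mean_has_sum(2,3)[OF I]])
      (use a q in auto)
  then have "(\<Sum>i\<in>I. a i powr q) \<le> card I * (sum a I / card I) powr q"
    using I by (simp add: field_simps card_gt_0_iff)
  then show ?thesis
    using card_powr_sum[OF I q(1) a] by simp
qed

lemma power_trace_finite: "power_trace q T < \<infinity> \<Longrightarrow> q > 0 \<Longrightarrow> power_trace q T = ennreal (power_norm q T powr q)"
  by (simp add: power_norm_powr)

context
  fixes S :: "'i \<Rightarrow> 'a::chilbert_space \<Rightarrow> 'a" and I :: "'i set" and R :: "'a \<Rightarrow> 'a" and q :: real
  assumes I: "finite I" "I \<noteq> {}" and S: "\<And>i. i \<in> I \<Longrightarrow> compact_positive (S i)"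
    and R_sum: "\<And>x. R x = (\<Sum>i\<in>I. S i x)" and q: "q > 0"
    and fin: "\<And>i. i \<in> I \<Longrightarrow> power_trace q (S i) < \<infinity>"
begin

lemma sum_power_trace:
  "(\<Sum>i\<in>I. power_trace q (S i)) = ennreal (\<Sum>i\<in>I. power_norm q (S i) powr q)"
proof -
  have "(\<Sum>i\<in>I. power_trace q (S i)) = (\<Sum>i\<in>I. ennreal (power_norm q (S i) powr q))"
    using fin q by (intro sum.cong power_trace_finite) auto
  then show ?thesis by simp
qed

text \<open>For \<open>q \<ge> 1\<close> finiteness comes with the triangle inequality; for
  \<open>q < 1\<close> subadditivity of the trace supplies the bound.\<close>

lemma power_trace_sum_finite: "power_trace q R < \<infinity>"
proof (cases "1 \<le> q")
  case True
  then show ?thesis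
    using power_norm_triangle(1)[OF I(1) S R_sum q _ fin] by simp
next
  case False
  then have "power_trace q R \<le> (\<Sum>i\<in>I. power_trace q (S i))"
    using power_trace_subadditive[OF I(1) S R_sum q] by simp
  then show ?thesis
    unfolding sum_power_trace by (simp add: order_le_less_trans)
qed

text \<open>Superadditivity controls the sum of the \<open>q\<close>-th powers of the norms.
  Exchanging it for the \<open>q\<close>-th power of their sum, by the power mean inequality,
  produces the factor \<open>card I powr (1 / q - 1)\<close>.\<close>

lemma power_norm_sum_ge:
  assumes "1 \<le> q"
  shows "card I powr (1 / q - 1) * (\<Sum>i\<in>I. power_norm q (S i)) \<le> power_norm q R"
proof (rule powr_le_imp_le[OF q power_norm_nonneg])
  have "ennreal (\<Sum>i\<in>I. power_norm q (S i) powr q) \<le> ennreal (power_norm q R powr q)"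
    using power_trace_superadditive[OF I(1) S R_sum q assms]
    by (simp add: sum_power_trace power_trace_finite[OF power_trace_sum_finite q])
  then have "(\<Sum>i\<in>I. power_norm q (S i) powr q) \<le> power_norm q R powr q"
    by simp
  then show "(card I powr (1 / q - 1) * (\<Sum>i\<in>I. power_norm q (S i))) powr q \<le> power_norm q R powr q"
    using power_sum_ge_mean[OF I assms, of "\<lambda>i. power_norm q (S i)"]
    by (simp add: power_norm_nonneg)
qed

lemma power_norm_sum_le:
  assumes "q \<le> 1"
  shows "power_norm q R \<le> card I powr (1 / q - 1) * (\<Sum>i\<in>I. power_norm q (S i))"
proof (rule powr_le_imp_le[OF q])
  have "ennreal (power_norm q R powr q) \<le> ennreal (\<Sum>i\<in>I. power_norm q (S i) powr q)"
    using power_trace_subadditive[OF I(1) S R_sum q assms]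
    by (simp add: sum_power_trace power_trace_finite[OF power_trace_sum_finite q])
  then have "power_norm q R powr q \<le> (\<Sum>i\<in>I. power_norm q (S i) powr q)"
    by (simp add: sum_nonneg)
  then show "power_norm q R powr q \<le> (card I powr (1 / q - 1) * (\<Sum>i\<in>I. power_norm q (S i))) powr q"
    using power_sum_le_mean[OF I q assms, of "\<lambda>i. power_norm q (S i)"]
    by (simp add: power_norm_nonneg)
qed (simp add: sum_nonneg power_norm_nonneg)

end

section \<open>From traces of powers to Schatten norms\<close>

lemma power_norm_scaleR:
  assumes T: "compact_positive T" and q: "q > 0" and fin: "power_trace q T < \<infinity>" and r: "0 \<le> r"
  shows "power_trace q (\<lambda>x. r *\<^sub>R T x) < \<infinity>"
    and "power_norm q (\<lambda>x. r *\<^sub>R T x) = r * power_norm q T"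
proof -
  obtain E l where E: "diagonal T E l" and l: "\<And>e. e \<in> E \<Longrightarrow> 0 \<le> l e"
    using compact_positive_eigenbasis[OF T] by blast
  have rE: "diagonal (\<lambda>x. r *\<^sub>R T x) E (\<lambda>e. r * l e)"
    using E by (simp add: diagonal_def bounded_clinear_scaleR)
  have "((\<lambda>e. r powr q * l e powr q) has_sum r powr q * power_norm q T powr q) E"
    by (intro has_sum_cmult_right power_norm_has_sum[OF E l q fin])
  then have sum: "((\<lambda>e. (r * l e) powr q) has_sum (r * power_norm q T) powr q) E"
    by (simp only: powr_mult)
  have nonneg: "0 \<le> r * l e" if "e \<in> E" for e
    using l[OF that] r by simp
  show "power_trace q (\<lambda>x. r *\<^sub>R T x) < \<infinity>"
    by (rule power_norm_eqI[OF rE nonneg q sum])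
  have "power_norm q (\<lambda>x. r *\<^sub>R T x) powr q = (r * power_norm q T) powr q"
    by (rule power_norm_eqI[OF rE nonneg q sum])
  then show "power_norm q (\<lambda>x. r *\<^sub>R T x) = r * power_norm q T"
    using powr_le_imp_le[OF q] r by (intro order_antisym) (simp_all add: power_norm_nonneg)
qed

lemma op_sqrt_square:
  assumes "compact_positive T"
  shows "op_sqrt T \<circ> op_sqrt T = T"
proof -
  obtain E l where E: "diagonal T E l" and l: "\<And>e. e \<in> E \<Longrightarrow> 0 \<le> l e"
    using compact_positive_eigenbasis[OF assms] by blast
  note Q = diagonal_op_sqrt[OF E l]
  show ?thesis
    using diagonal_compose[OF Q Q] E by (rule diagonal_unique) (simp_all add: l)
qed

lemma op_sqrt_adjoint:
  assumes "compact_positive T"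
  shows "cadjoint (op_sqrt T) = op_sqrt T"
proof -
  obtain E l where E: "diagonal T E l" and l: "\<And>e. e \<in> E \<Longrightarrow> 0 \<le> l e"
    using compact_positive_eigenbasis[OF assms] by blast
  have "positive_operator (op_sqrt T)"
    using diagonal_op_sqrt[OF E l] by (rule diagonal_positive) (simp_all add: l)
  then show ?thesis
    by (intro cadjoint_eqI positive_operator_selfadjoint)
qed

text \<open>The exponent \<open>p / 2\<close> originates here: on eigenvalues,
  \<open>sqrt (l e) powr p = l e powr (p / 2)\<close>.\<close>

lemma trace_op_sqrt:
  assumes "compact_positive T" and p: "p > 0"
  shows "pos_trace (op_powr (op_sqrt T) p) = power_trace (p / 2) T"
proof -
  obtain E l where E: "diagonal T E l" and l: "\<And>e. e \<in> E \<Longrightarrow> 0 \<le> l e"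
    using compact_positive_eigenbasis[OF assms(1)] by blast
  have "pos_trace (op_powr (op_sqrt T) p) = (\<Sum>\<^sub>\<infinity>e\<in>E. ennreal (sqrt (l e) powr p))"
    using power_trace_diagonal[OF diagonal_op_sqrt[OF E l] _ p] l by (simp add: power_trace_def)
  also have "\<dots> = (\<Sum>\<^sub>\<infinity>e\<in>E. ennreal (l e powr (p / 2)))"
    using l by (intro infsum_cong) (simp add: powr_half_sqrt[symmetric] powr_powr)
  also have "\<dots> = power_trace (p / 2) T"
    using power_trace_diagonal[OF E l, of "p / 2"] p by simp
  finally show ?thesis .
qed

lemma square_powr_inverse: "(x powr (1 / p))\<^sup>2 = x powr (1 / (p / 2))" for x p :: real
  by (simp add: power2_eq_square flip: powr_add)

lemma schatten_norm_square:
  assumes "compact_operator T" "p > 0"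
  shows "(schatten_norm p T)\<^sup>2 = power_norm (p / 2) (cadjoint T \<circ> T)"
  unfolding schatten_norm_def op_abs_def power_norm_def
  using trace_op_sqrt[OF compact_positive_adjoint_compose[OF assms(1)] assms(2)]
  by (simp only: square_powr_inverse)

text \<open>The root is self-adjoint with square \<open>T\<close>, so it is its own absolute
  value.\<close>

lemma schatten_norm_op_sqrt_square:
  assumes "compact_positive T" "p > 0"
  shows "(schatten_norm p (op_sqrt T))\<^sup>2 = power_norm (p / 2) T"
  unfolding schatten_norm_def op_abs_def power_norm_def
  using trace_op_sqrt[OF assms]
  by (simp only: square_powr_inverse op_sqrt_square[OF assms(1)] op_sqrt_adjoint[OF assms(1)])

lemma schatten_class_power_trace:
  assumes "T \<in> schatten_class p" "p > 0"
  shows "compact_operator T" "power_trace (p / 2) (cadjoint T \<circ> T) < \<infinity>"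
  using assms trace_op_sqrt[OF compact_positive_adjoint_compose, of T p]
  by (auto simp: schatten_class_def op_abs_def)

lemma op_abs_square:
  assumes "compact_operator T"
  shows "(op_abs T ^^ 2) x = cadjoint T (T x)"
  using op_sqrt_square[OF compact_positive_adjoint_compose[OF assms]]
  by (simp add: op_abs_def numeral_2_eq_2 fun_eq_iff)

lemma cadjoint_add_scaleR:
  assumes A: "bounded_clinear A" and B: "bounded_clinear B"
  shows "cadjoint (\<lambda>x. A x + r *\<^sub>R B x) = (\<lambda>y. cadjoint A y + r *\<^sub>R cadjoint B y)"
  by (rule cadjoint_eqI)
    (simp add: cinner.add_left cinner.add_right cinner.scaleR_left cinner.scaleR_right
      cinner_cadjoint[OF A] cinner_cadjoint[OF B])

text \<open>The adjoint of the hypothesis, obtained by moving both factors across the inner product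
  with \<open>z\<close>. It disposes of the second half of the cross terms.\<close>

lemma adjoint_sum_zero:
  assumes A: "\<And>i. i \<in> I \<Longrightarrow> bounded_clinear (A i)" and B: "\<And>j. j \<in> J \<Longrightarrow> bounded_clinear (B j)"
    and zero: "\<And>x. (\<Sum>i\<in>I. \<Sum>j\<in>J. cadjoint (A i) (B j x)) = 0"
  shows "(\<Sum>i\<in>I. \<Sum>j\<in>J. cadjoint (B j) (A i x)) = 0"
proof (rule cinner_eqI)
  fix z
  have "cinner z (\<Sum>i\<in>I. \<Sum>j\<in>J. cadjoint (B j) (A i x)) =
      (\<Sum>i\<in>I. \<Sum>j\<in>J. cinner z (cadjoint (B j) (A i x)))"
    by (simp add: cinner.sum_right)
  also have "\<dots> = (\<Sum>i\<in>I. \<Sum>j\<in>J. cinner (cadjoint (A i) (B j z)) x)"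
    by (intro sum.cong refl) (simp only: cinner_cadjoint_left[OF A] cinner_cadjoint[OF B])
  also have "\<dots> = cinner (\<Sum>i\<in>I. \<Sum>j\<in>J. cadjoint (A i) (B j z)) x"
    by (simp add: cinner.sum_left)
  finally show "cinner z (\<Sum>i\<in>I. \<Sum>j\<in>J. cadjoint (B j) (A i x)) = cinner z 0"
    by (simp add: zero cinner.zero_left cinner.zero_right)
qed

text \<open>Every \<open>A i\<close> and every \<open>B j\<close> occurs in \<open>card I\<close>
  pairs, which gives the factor. The sign survives only in front of the cross terms, and these
  cancel in total, so \<open>s * s = 1\<close> treats both signs at once.\<close>

lemma sum_square_expansion:
  fixes A B :: "'i \<Rightarrow> 'a::chilbert_space \<Rightarrow> 'a"
  assumes A: "\<And>i. i \<in> I \<Longrightarrow> bounded_clinear (A i)" and B: "\<And>i. i \<in> I \<Longrightarrow> bounded_clinear (B i)"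
    and zero: "\<And>x. (\<Sum>i\<in>I. \<Sum>j\<in>I. cadjoint (A i) (B j x)) = 0" and s: "s * s = (1::real)"
  defines "X \<equiv> \<lambda>(i, j) x. A i x + s *\<^sub>R B j x"
  shows "(\<Sum>k\<in>I \<times> I. (cadjoint (X k) \<circ> X k) x) =
    real (card I) *\<^sub>R (\<Sum>i\<in>I. cadjoint (A i) (A i x) + cadjoint (B i) (B i x))"
proof -
  have "(cadjoint (X (i, j)) \<circ> X (i, j)) x = cadjoint (A i) (A i x) + cadjoint (B j) (B j x) +
      s *\<^sub>R (cadjoint (A i) (B j x) + cadjoint (B j) (A i x))" if "i \<in> I" "j \<in> I" for i j
  proof -
    note lin = bounded_linear.linear[OF bounded_clinear_D(1)[OF bounded_clinear_cadjoint]]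
    note linA = lin[OF A[OF that(1)]] and linB = lin[OF B[OF that(2)]]
    show ?thesis
      by (simp add: X_def cadjoint_add_scaleR[OF A[OF that(1)] B[OF that(2)]] s
          linear_add[OF linA] linear_add[OF linB] linear_scale[OF linA] linear_scale[OF linB]
          scaleR_right_distrib)
  qed
  then have "(\<Sum>k\<in>I \<times> I. (cadjoint (X k) \<circ> X k) x) =
      (\<Sum>i\<in>I. \<Sum>j\<in>I. cadjoint (A i) (A i x) + cadjoint (B j) (B j x) +
        s *\<^sub>R (cadjoint (A i) (B j x) + cadjoint (B j) (A i x)))"
    unfolding sum.cartesian_product by (intro sum.cong refl) auto
  also have "\<dots> = real (card I) *\<^sub>R (\<Sum>i\<in>I. cadjoint (A i) (A i x)) +
      real (card I) *\<^sub>R (\<Sum>i\<in>I. cadjoint (B i) (B i x)) +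
      s *\<^sub>R ((\<Sum>i\<in>I. \<Sum>j\<in>I. cadjoint (A i) (B j x)) + (\<Sum>i\<in>I. \<Sum>j\<in>I. cadjoint (B j) (A i x)))"
    by (simp add: sum.distrib sum_constant_scaleR flip: scaleR_sum_right)
  finally show ?thesis
    by (simp add: zero adjoint_sum_zero[OF A B zero] sum.distrib scaleR_right_distrib)
qed

theorem theorem2p5:
  fixes A B :: "nat \<Rightarrow> 'a::chilbert_space \<Rightarrow> 'a" and n :: nat and p :: real
  assumes separable: "\<exists>D::'a set. countable D \<and> closure D = UNIV"
    and "n \<ge> 1" and "p > 0"
    and "\<And>i. i \<in> {1..n} \<Longrightarrow> A i \<in> schatten_class p"
    and "\<And>i. i \<in> {1..n} \<Longrightarrow> B i \<in> schatten_class p"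
    and "\<forall>x. (\<Sum>i=1..n. \<Sum>j=1..n. cadjoint (A i) (B j x)) = 0"
  shows "\<forall>s\<in>{1, -1::real}.
    (p \<le> 2 \<longrightarrow>
      (\<Sum>i=1..n. \<Sum>j=1..n. (schatten_norm p (\<lambda>x. A i x + s *\<^sub>R B j x))\<^sup>2)
        \<le> real n powr (2 / p) *
           (\<Sum>i=1..n. (schatten_norm p (op_sqrt (\<lambda>x.
              (op_abs (A i) ^^ 2) x + (op_abs (B i) ^^ 2) x)))\<^sup>2)) \<and>
    (2 \<le> p \<longrightarrow>
      real n powr (2 / p) *
           (\<Sum>i=1..n. (schatten_norm p (op_sqrt (\<lambda>x.
              (op_abs (A i) ^^ 2) x + (op_abs (B i) ^^ 2) x)))\<^sup>2)
        \<le> (\<Sum>i=1..n. \<Sum>j=1..n. (schatten_norm p (\<lambda>x. A i x + s *\<^sub>R B j x))\<^sup>2))"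
proof
  fix s :: real assume "s \<in> {1, -1}"
  then have s: "s * s = 1"
    by auto
  define I where "I = {1..n}"
  define q where "q = p / 2"
  have I: "finite I" "I \<noteq> {}" "card I = n" and n: "real n > 0"
    using \<open>n \<ge> 1\<close> by (auto simp: I_def)
  have q: "q > 0"
    using \<open>p > 0\<close> by (simp add: q_def)
  have cA: "compact_operator (A i)" "power_trace q (cadjoint (A i) \<circ> A i) < \<infinity>"
    and cB: "compact_operator (B i)" "power_trace q (cadjoint (B i) \<circ> B i) < \<infinity>" if "i \<in> I" for i
    using assms(3-5) schatten_class_power_trace[of _ p] that by (auto simp: I_def q_def)
  then have bc: "bounded_clinear (A i)" "bounded_clinear (B i)" if "i \<in> I" for i
    using that by (auto simp: compact_operator_def)
  define X where "X = (\<lambda>(i, j) x. A i x + s *\<^sub>R B j x)"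
  define S where "S k = cadjoint (X k) \<circ> X k" for k
  define T where "T i x = cadjoint (A i) (A i x) + cadjoint (B i) (B i x)" for i x
  define R where "R x = (\<Sum>i\<in>I. T i x)" for x
  \<comment> \<open>\<open>N\<close> links the two sides of the theorem: it is \<open>n\<close>
    times the sum of the \<open>T i\<close> by definition and the sum of the \<open>S k\<close> by
    \<open>sum_square_expansion\<close>.\<close>
  define N where "N x = real n *\<^sub>R R x" for x
  have cX: "compact_operator (X k)" if "k \<in> I \<times> I" for k
    using that cA(1) cB(1) by (auto simp: X_def intro!: compact_operator_add compact_operator_scaleR)
  have cS: "compact_positive (S k)" if "k \<in> I \<times> I" for k
    unfolding S_def using cX[OF that] by (rule compact_positive_adjoint_compose)
  have cT: "compact_positive (T i)" and fT: "power_trace q (T i) < \<infinity>" if i: "i \<in> I" for i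
  proof -
    \<comment> \<open>The two summands of \<open>T i\<close> are indexed by \<open>bool\<close>, so
      that the results on finite sums apply to them.\<close>
    define U where "U b = (if b then cadjoint (A i) \<circ> A i else cadjoint (B i) \<circ> B i)" for b
    have U: "compact_positive (U b)" "power_trace q (U b) < \<infinity>" for b
      using cA cB i by (auto simp: U_def intro!: compact_positive_adjoint_compose)
    have T_sum: "T i x = (\<Sum>b\<in>UNIV. U b x)" for x
      by (simp add: T_def U_def UNIV_bool)
    show "compact_positive (T i)"
      using compact_positive_total[of UNIV U, OF _ U(1) T_sum] by simp
    show "power_trace q (T i) < \<infinity>"
      by (rule power_trace_sum_finite[of UNIV U, OF _ _ U(1) T_sum q U(2)]) auto
  qed
  have cR: "compact_positive R"
    by (rule compact_positive_total[OF I(1) cT R_def])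
  have fR: "power_trace q R < \<infinity>"
    by (rule power_trace_sum_finite[OF I(1,2) cT R_def q fT])
  have fN: "power_trace q N < \<infinity>" and norm_N: "power_norm q N = real n * power_norm q R"
    unfolding N_def[abs_def] by (rule power_norm_scaleR[OF cR q fR], simp)+
  have zero: "(\<Sum>i\<in>I. \<Sum>j\<in>I. cadjoint (A i) (B j x)) = 0" for x
    using assms(6) by (simp add: I_def)
  have N_sum: "N x = (\<Sum>k\<in>I \<times> I. S k x)" for x
    unfolding N_def R_def T_def S_def X_def
    using sum_square_expansion[OF bc zero s] I(3) by simp
  have II: "finite (I \<times> I)"
    using I(1) by simp
  have S_eq: "(\<Sum>i=1..n. \<Sum>j=1..n. (schatten_norm p (\<lambda>x. A i x + s *\<^sub>R B j x))\<^sup>2) =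
      (\<Sum>k\<in>I \<times> I. power_norm q (S k))"
    using schatten_norm_square[OF cX \<open>p > 0\<close>]
    unfolding I_def[symmetric] sum.cartesian_product
    by (intro sum.cong refl) (auto simp: X_def S_def q_def)
  have T_eq: "(\<Sum>i=1..n. (schatten_norm p (op_sqrt (\<lambda>x.
      (op_abs (A i) ^^ 2) x + (op_abs (B i) ^^ 2) x)))\<^sup>2) = (\<Sum>i\<in>I. power_norm q (T i))"
    unfolding I_def[symmetric]
  proof (rule sum.cong[OF refl])
    fix i assume i: "i \<in> I"
    have "(\<lambda>x. (op_abs (A i) ^^ 2) x + (op_abs (B i) ^^ 2) x) = T i"
      using cA(1)[OF i] cB(1)[OF i] by (simp add: op_abs_square T_def[abs_def])
    then show "(schatten_norm p (op_sqrt (\<lambda>x. (op_abs (A i) ^^ 2) x + (op_abs (B i) ^^ 2) x)))\<^sup>2 =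
        power_norm q (T i)"
      using schatten_norm_op_sqrt_square[OF cT[OF i] \<open>p > 0\<close>] by (simp add: q_def)
  qed
  \<comment> \<open>With \<open>1 / q = 2 / p\<close>, the constant splits into the factor
    \<open>n\<close> of \<open>N\<close> and the factor \<open>n powr (1 / q - 1)\<close> of the
    power mean inequality.\<close>
  have n_powr: "real n powr (2 / p) * t = real n * (real (card I) powr (1 / q - 1) * t)" for t
    using n I(3) \<open>p > 0\<close> by (simp add: powr_diff q_def)
  show "(p \<le> 2 \<longrightarrow>
      (\<Sum>i=1..n. \<Sum>j=1..n. (schatten_norm p (\<lambda>x. A i x + s *\<^sub>R B j x))\<^sup>2)
        \<le> real n powr (2 / p) *
           (\<Sum>i=1..n. (schatten_norm p (op_sqrt (\<lambda>x.
              (op_abs (A i) ^^ 2) x + (op_abs (B i) ^^ 2) x)))\<^sup>2)) \<and>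
    (2 \<le> p \<longrightarrow>
      real n powr (2 / p) *
           (\<Sum>i=1..n. (schatten_norm p (op_sqrt (\<lambda>x.
              (op_abs (A i) ^^ 2) x + (op_abs (B i) ^^ 2) x)))\<^sup>2)
        \<le> (\<Sum>i=1..n. \<Sum>j=1..n. (schatten_norm p (\<lambda>x. A i x + s *\<^sub>R B j x))\<^sup>2))"
    unfolding S_eq T_eq n_powr
  proof (intro conjI impI)
    assume "p \<le> 2"
    then have q1: "q \<le> 1"
      by (simp add: q_def)
    have "(\<Sum>k\<in>I \<times> I. power_norm q (S k)) \<le> real n * power_norm q R"
      using power_norm_reverse_triangle[OF II cS N_sum q q1 fN] by (simp add: norm_N)
    also have "\<dots> \<le> real n * (real (card I) powr (1 / q - 1) * (\<Sum>i\<in>I. power_norm q (T i)))"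
      using power_norm_sum_le[OF I(1,2) cT R_def q fT q1] by (intro mult_left_mono) auto
    finally show "(\<Sum>k\<in>I \<times> I. power_norm q (S k)) \<le>
        real n * (real (card I) powr (1 / q - 1) * (\<Sum>i\<in>I. power_norm q (T i)))" .
  next
    assume "2 \<le> p"
    then have q1: "1 \<le> q"
      by (simp add: q_def)
    \<comment> \<open>The triangle inequality presupposes finite traces of the \<open>S k\<close>.
      They are bounded by the trace for \<open>N\<close>, whose finiteness came from the
      \<open>T i\<close>.\<close>
    have fS: "power_trace q (S k) < \<infinity>" if "k \<in> I \<times> I" for k
    proof -
      have "power_trace q (S k) \<le> (\<Sum>k\<in>I \<times> I. power_trace q (S k))"
        using II that by (intro member_le_sum) auto
      also have "\<dots> \<le> power_trace q N"
        by (rule power_trace_superadditive[OF II cS N_sum q q1])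
      finally show ?thesis
        using fN by (rule order_le_less_trans)
    qed
    have "real n * (real (card I) powr (1 / q - 1) * (\<Sum>i\<in>I. power_norm q (T i))) \<le> real n * power_norm q R"
      using power_norm_sum_ge[OF I(1,2) cT R_def q fT q1] by (intro mult_left_mono) auto
    also have "\<dots> \<le> (\<Sum>k\<in>I \<times> I. power_norm q (S k))"
      using power_norm_triangle(2)[OF II cS N_sum q q1 fS] by (simp add: norm_N)
    finally show "real n * (real (card I) powr (1 / q - 1) * (\<Sum>i\<in>I. power_norm q (T i)))
        \<le> (\<Sum>k\<in>I \<times> I. power_norm q (S k))" .
  qed
qed

end
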